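(* Let $S$ be a subring of $\overline{\mathbb{Q}}$. Then there exists a subring $T$ of $S$ such that $T$ has the Northcott property and the field of fractions of $S$ and the field of fractions of $T$ are identical.
   Context: $\overline{\mathbb{Q}}$ is a fixed algebraic closure of $\mathbb{Q}$; fields of fractions are taken inside $\overline{\mathbb{Q}}$. The absolute multiplicative Weil height of $\alpha$ in a number field $K$ is $H(\alpha)=\prod_v\max\{1,|\alpha|_v\}^{d_v/[K:\mathbb{Q}]}$, the product over all places $v$ of $K$, where $|\cdot|_v$ extends the usual archimedean or $p$-adic absolute value on $\mathbb{Q}$ and $d_v=[K_v:\mathbb{Q}_v]$; it is independent of the choice of $K\ni\alpha$. Put $h(\alpha)=\log H(\alpha)$. A set $S\subseteq\overline{\mathbb{Q}}$ has the Northcott property if $\#\{\alpha\in S: h(\alpha)\le X\}<\infty$ for every $X\ge 0$. *)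

theory Defs
  imports
    "HOL-Algebra.Algebraic_Closure_Type"
    "HOL-Algebra.Generated_Fields"
    "HOL-Analysis.Abstract_Metric_Spaces"
begin

text \<open>The fixed algebraic closure of the rationals is the field of algebraic complex numbers.\<close>

definition Qbar :: "complex ring" where
  "Qbar = ring_of_type_algebra\<lparr>carrier := {z. algebraic z}\<rparr>"

definition fraction_field :: "complex set \<Rightarrow> complex set" where
  "fraction_field S = {a / b | a b. a \<in> S \<and> b \<in> S \<and> b \<noteq> 0}"

definition padic_abs :: "nat \<Rightarrow> rat \<Rightarrow> real" where
  "padic_abs p q =
     (if q = 0 then 0
      else case quotient_of q of (a, b) \<Rightarrow>
        real p powi (int (multiplicity (int p) b) - int (multiplicity (int p) a)))"

definition absolute_value_on :: "complex set \<Rightarrow> (complex \<Rightarrow> real) \<Rightarrow> bool" where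
  "absolute_value_on K v \<longleftrightarrow>
     (\<forall>x\<in>K. 0 \<le> v x) \<and>
     (\<forall>x\<in>K. v x = 0 \<longleftrightarrow> x = 0) \<and>
     (\<forall>x\<in>K. \<forall>y\<in>K. v (x * y) = v x * v y) \<and>
     (\<forall>x\<in>K. \<forall>y\<in>K. v (x + y) \<le> v x + v y)"

text \<open>
  A place of a number field \<open>K\<close> is represented by the unique absolute value in its class that
  extends the usual archimedean or a \<open>p\<close>-adic absolute value on the rationals.  Absolute values
  on \<open>K\<close> are total functions set to \<open>0\<close> outside \<open>K\<close>, so that distinct elements of
  \<open>places K\<close> are distinct places, and \<open>\<lambda>a b. v (a - b)\<close> satisfies the axioms of
  \<open>Metric_space K\<close>, some of which are not relativised to \<open>K\<close>.
\<close>

definition places :: "complex set \<Rightarrow> (complex \<Rightarrow> real) set" where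
  "places K =
     {v. absolute_value_on K v \<and> (\<forall>x. x \<notin> K \<longrightarrow> v x = 0) \<and>
         ((\<forall>q::rat. v (of_rat q) = \<bar>real_of_rat q\<bar>) \<or>
          (\<exists>p::nat. Factorial_Ring.prime p \<and> (\<forall>q::rat. v (of_rat q) = padic_abs p q)))}"

text \<open>
  The completion of \<open>K\<close> at \<open>v\<close> is the ring of \<open>v\<close>-Cauchy sequences in \<open>K\<close> modulo the
  null sequences; the completion of the rationals is embedded in it as the set of classes of
  Cauchy sequences of rationals.
\<close>

definition cauchy_ring :: "complex set \<Rightarrow> (complex \<Rightarrow> real) \<Rightarrow> (nat \<Rightarrow> complex) ring" where
  "cauchy_ring K v =
     \<lparr>carrier = {x. Metric_space.MCauchy K (\<lambda>a b. v (a - b)) x},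
      monoid.mult = (\<lambda>x y n. x n * y n),
      one = (\<lambda>n. 1),
      ring.zero = (\<lambda>n. 0),
      add = (\<lambda>x y n. x n + y n)\<rparr>"

definition null_sequences :: "complex set \<Rightarrow> (complex \<Rightarrow> real) \<Rightarrow> (nat \<Rightarrow> complex) set" where
  "null_sequences K v =
     {x \<in> carrier (cauchy_ring K v).
        limitin (Metric_space.mtopology K (\<lambda>a b. v (a - b))) x 0 sequentially}"

definition completion :: "complex set \<Rightarrow> (complex \<Rightarrow> real) \<Rightarrow> (nat \<Rightarrow> complex) set ring" where
  "completion K v = cauchy_ring K v Quot null_sequences K v"

definition rat_completion :: "complex set \<Rightarrow> (complex \<Rightarrow> real) \<Rightarrow> (nat \<Rightarrow> complex) set set" where
  "rat_completion K v =
     {null_sequences K v +>\<^bsub>cauchy_ring K v\<^esub> x | x.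
        x \<in> carrier (cauchy_ring K v) \<and> range x \<subseteq> \<rat>}"

definition local_degree :: "complex set \<Rightarrow> (complex \<Rightarrow> real) \<Rightarrow> nat" where
  "local_degree K v =
     ring.dim (completion K v) (rat_completion K v) (carrier (completion K v))"

definition global_degree :: "complex set \<Rightarrow> nat" where
  "global_degree K = ring.dim Qbar \<rat> K"

text \<open>
  The product over all places is written as the product over the finitely many places whose factor
  differs from \<open>1\<close>, since \<open>prod\<close> over an infinite index set is \<open>1\<close> by convention.
\<close>

definition height_over :: "complex set \<Rightarrow> complex \<Rightarrow> real" where
  "height_over K \<alpha> =
     (\<Prod>v | v \<in> places K \<and> max 1 (v \<alpha>) \<noteq> 1.
        max 1 (v \<alpha>) powr (real (local_degree K v) / real (global_degree K)))"

text \<open>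
  The value \<open>height_over K \<alpha>\<close> is the same for all number fields \<open>K\<close> containing \<open>\<alpha>\<close>;
  the field generated by \<open>\<alpha>\<close> over the rationals is used here.
\<close>

definition weil_height :: "complex \<Rightarrow> real" where
  "weil_height \<alpha> = height_over (generate_field Qbar {\<alpha>}) \<alpha>"

definition log_weil_height :: "complex \<Rightarrow> real" where
  "log_weil_height \<alpha> = ln (weil_height \<alpha>)"

definition northcott :: "complex set \<Rightarrow> bool" where
  "northcott S \<longleftrightarrow> (\<forall>B\<ge>0. finite {\<alpha> \<in> S. log_weil_height \<alpha> \<le> B})"

end

theory Submission
  imports Defs "Jordan_Normal_Form.Char_Poly"
begin

text \<open>
  Let \<open>a\<^sub>0, a\<^sub>1, \<dots>\<close> enumerate the algebraic integers of \<open>S\<close> and let \<open>K\<^sub>n\<close> be the number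
  field generated by the \<open>a\<^sub>k\<close> with \<open>k < n\<close>.  Two finiteness statements give the theorem.

  First, a number field contains only finitely many algebraic integers of bounded height
  (\<open>northcott_number_field\<close>).  The height of an algebraic integer \<open>\<alpha>\<close> is at least
  \<open>max 1 \<bar>\<zeta>\<bar> powr (1 / d)\<close> for every conjugate \<open>\<zeta>\<close> of \<open>\<alpha>\<close>, where \<open>d\<close> is the degree of \<open>\<rat>(\<alpha>)\<close>,
  because all factors in the product that defines it are at least \<open>1\<close> and the place of \<open>\<zeta>\<close>
  contributes such a factor.  So the minimal polynomial of \<open>\<alpha>\<close> has bounded degree and bounded
  integer coefficients.

  Secondly, an algebraic integer \<open>\<alpha>\<close> outside a number field \<open>K\<close> is congruent to an element of
  \<open>K\<close> modulo only finitely many positive integers (\<open>exists_separating_modulus\<close>): it has a conjugate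
  \<open>\<alpha>' \<noteq> \<alpha>\<close> over \<open>K\<close>, and if \<open>\<alpha> = t + m r\<close> with \<open>t\<close> in \<open>K\<close>, then \<open>(\<alpha> - \<alpha>') / m\<close> is
  a nonzero algebraic integer.  Hence there are positive integers \<open>m\<^sub>0\<close>, \<open>m\<^sub>1\<close> and so on, each
  dividing the next, such that no algebraic integer of \<open>K\<^sub>n\<^sub>+\<^sub>1\<close> outside \<open>K\<^sub>n\<close> with logarithmic
  height at most \<open>n\<close> is congruent to an element of \<open>K\<^sub>n\<close> modulo \<open>m\<^sub>n\<close>.

  Let \<open>T\<close> consist of the algebraic integers in \<open>S\<close> that, for every \<open>n\<close>, are congruent modulo \<open>m\<^sub>n\<close>
  to an algebraic integer of \<open>K\<^sub>n\<close>.  This is a ring.  It contains \<open>m\<^sub>k a\<^sub>k\<close> for every \<open>k\<close>, so it has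
  the same fractions as \<open>S\<close>.  An element of \<open>T\<close> that first appears in \<open>K\<^sub>n\<^sub>+\<^sub>1\<close> has height more
  than \<open>n\<close>, so the elements of height at most \<open>B\<close> all lie in one number field, and there are
  finitely many of them.

  The bound for the height rests on a description of places.  The product over the places is
  meaningful only if finitely many of them are larger than \<open>1\<close> at \<open>\<alpha>\<close>: the \<open>p\<close>-adic ones are at
  most \<open>1\<close> at algebraic integers (\<open>algebraic_int_v_le_1\<close>), and the archimedean ones all come
  from conjugates (\<open>archimedean_is_embedding\<close>).  The completion at the place of a conjugate is
  isomorphic to the real or the complex numbers, so its local degree is positive
  (\<open>local_degree_pos\<close>).
\<close>

section \<open>Algebraic integers form a ring\<close>

text \<open>
  The hypothesis says that the numbers \<open>b i\<close> form an eigenvector, with eigenvalue \<open>x\<close>, of the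
  integer matrix \<open>A\<close>.  So \<open>x\<close> is a root of the characteristic polynomial of \<open>A\<close>, which is monic
  and has integer coefficients.
\<close>
lemma algebraic_int_if_stable_lattice:
  fixes x :: complex and b :: "'i \<Rightarrow> complex" and A :: "'i \<Rightarrow> 'i \<Rightarrow> int"
  assumes "finite I" and "i0 \<in> I" "b i0 \<noteq> 0"
    and stable: "\<And>i. i \<in> I \<Longrightarrow> x * b i = (\<Sum>j\<in>I. of_int (A i j) * b j)"
  shows "algebraic_int x"
proof -
  define n where "n = card I"
  obtain f where f: "bij_betw f {..<n} I"
    using ex_bij_betw_nat_finite[OF \<open>finite I\<close>] by (auto simp: n_def atLeast0LessThan)
  define M where "M = Matrix.mat n n (\<lambda>(i, j). A (f i) (f j))"
  define v where "v = Matrix.vec n (\<lambda>i. b (f i))"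
  have M: "M \<in> carrier_mat n n" by (simp add: M_def)
  obtain k0 where k0: "k0 < n" "f k0 = i0"
    using f \<open>i0 \<in> I\<close> by (auto simp: bij_betw_def)
  have "eigenvector (map_mat of_int M) v x"
    unfolding eigenvector_def
  proof (intro conjI)
    show "v \<in> carrier_vec (dim_row (map_mat of_int M :: complex mat))"
      by (simp add: v_def M_def)
    show "v \<noteq> 0\<^sub>v (dim_row (map_mat of_int M :: complex mat))"
      using k0 assms(3) by (auto simp: v_def M_def vec_eq_iff)
    show "map_mat of_int M *\<^sub>v v = x \<cdot>\<^sub>v v"
    proof (rule eq_vecI)
      fix i assume "i < dim_vec (x \<cdot>\<^sub>v v)"
      hence i: "i < n" by (simp add: v_def)
      have "(map_mat of_int M *\<^sub>v v) $ i = (\<Sum>j\<in>{..<n}. of_int (A (f i) (f j)) * b (f j))"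
        using i by (simp add: M_def v_def scalar_prod_def atLeast0LessThan)
      also have "\<dots> = (\<Sum>j\<in>I. of_int (A (f i) j) * b j)"
        by (rule sum.reindex_bij_betw[OF f])
      also have "\<dots> = x * b (f i)"
        using stable f i by (auto simp: bij_betw_def)
      finally show "(map_mat of_int M *\<^sub>v v) $ i = (x \<cdot>\<^sub>v v) $ i"
        using i by (simp add: v_def)
    qed (simp add: M_def v_def)
  qed
  hence "poly (char_poly (map_mat of_int M)) x = 0"
    using eigenvalue_root_char_poly[of "map_mat of_int M" n x] M by (auto simp: eigenvalue_def)
  hence "poly (map_poly of_int (char_poly M)) x = 0"
    using of_int_hom.char_poly_hom[OF M, where ?'a = complex] by simp
  moreover have "Polynomial.lead_coeff (char_poly M) = 1"
    using degree_monic_char_poly[OF M] by simp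
  ultimately show ?thesis
    unfolding algebraic_int_altdef_ipoly by blast
qed

text \<open>
  The matrix \<open>c\<close> is the companion matrix of a monic integer polynomial with root \<open>x\<close>, so it
  describes multiplication by \<open>x\<close> on the lattice spanned by the powers of \<open>x\<close> below its degree.
\<close>
lemma algebraic_int_power_basis:
  fixes x :: complex
  assumes "algebraic_int x"
  obtains m :: nat and c :: "nat \<Rightarrow> nat \<Rightarrow> int"
  where "m > 0" "\<And>i. i < m \<Longrightarrow> x * x ^ i = (\<Sum>k<m. of_int (c i k) * x ^ k)"
proof -
  obtain p where p: "poly (map_poly of_int p) x = 0" "Polynomial.lead_coeff p = (1::int)"
    using assms unfolding algebraic_int_altdef_ipoly by blast
  define m where "m = Polynomial.degree p"
  have m: "m > 0"
  proof (rule ccontr)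
    assume "\<not> m > 0"
    then obtain c where "p = [:c:]"
      unfolding m_def using degree_eq_zeroE by blast
    with p show False by (auto simp: map_poly_pCons)
  qed
  have "poly (map_poly of_int p) x = (\<Sum>k\<le>m. of_int (Polynomial.coeff p k) * x ^ k)"
    by (simp add: poly_altdef m_def)
  also have "\<dots> = x ^ m + (\<Sum>k<m. of_int (Polynomial.coeff p k) * x ^ k)"
    using p(2) by (simp add: m_def lessThan_Suc_atMost[symmetric])
  finally have xm: "x ^ m = (\<Sum>k<m. of_int (- Polynomial.coeff p k) * x ^ k)"
    using p(1) by (simp add: sum_negf eq_neg_iff_add_eq_0)
  define c where "c = (\<lambda>i k. if Suc i = m then - Polynomial.coeff p k else if k = Suc i then 1 else 0)"
  have "x * x ^ i = (\<Sum>k<m. of_int (c i k) * x ^ k)" if "i < m" for i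
  proof (cases "Suc i = m")
    case True
    then show ?thesis using xm by (simp add: c_def flip: power_Suc)
  next
    case False
    with that have "Suc i < m" by simp
    have "(\<Sum>k<m. of_int (c i k) * x ^ k) = (\<Sum>k<m. if k = Suc i then x ^ k else 0)"
      using False by (intro sum.cong) (auto simp: c_def)
    also have "\<dots> = x ^ Suc i" using \<open>Suc i < m\<close> by simp
    finally show ?thesis by simp
  qed
  with m show ?thesis using that by blast
qed

text \<open>
  The lattice spanned by the products \<open>x ^ i * y ^ j\<close> with small exponents is stable under
  multiplication by \<open>x\<close> and by \<open>y\<close>, hence by their sum and product.
\<close>
lemma
  fixes x y :: complex
  assumes "algebraic_int x" "algebraic_int y"
  shows algebraic_int_add: "algebraic_int (x + y)"
    and algebraic_int_mult: "algebraic_int (x * y)"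
proof -
  obtain m c where m: "m > 0" and c: "\<And>i. i < m \<Longrightarrow> x * x ^ i = (\<Sum>k<m. of_int (c i k) * x ^ k)"
    using algebraic_int_power_basis[OF assms(1)] by metis
  obtain n d where n: "n > 0" and d: "\<And>j. j < n \<Longrightarrow> y * y ^ j = (\<Sum>l<n. of_int (d j l) * y ^ l)"
    using algebraic_int_power_basis[OF assms(2)] by metis
  define b where "b = (\<lambda>(i, j). x ^ i * y ^ j)"
  let ?I = "{..<m} \<times> {..<n}"
  have I: "finite ?I" "(0, 0) \<in> ?I" "b (0, 0) \<noteq> 0" using m n by (auto simp: b_def)
  show "algebraic_int (x * y)"
  proof (rule algebraic_int_if_stable_lattice[where b = b, OF I, where A = "\<lambda>(i, j) (k, l). c i k * d j l"])
    fix z assume "z \<in> ?I"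
    then obtain i j where z: "z = (i, j)" "i < m" "j < n" by auto
    have "x * y * b z = (x * x ^ i) * (y * y ^ j)" by (simp add: z b_def)
    also have "\<dots> = (\<Sum>(k, l)\<in>?I. of_int (c i k * d j l) * b (k, l))"
      using z by (simp add: c d sum_product sum.cartesian_product b_def mult_ac)
    finally show "x * y * b z = (\<Sum>w\<in>?I. of_int ((case z of (i, j) \<Rightarrow> \<lambda>(k, l). c i k * d j l) w) * b w)"
      by (simp add: z case_prod_unfold)
  qed
  show "algebraic_int (x + y)"
  proof (rule algebraic_int_if_stable_lattice[where b = b, OF I,
        where A = "\<lambda>(i, j) (k, l). (if l = j then c i k else 0) + (if k = i then d j l else 0)"])
    fix z assume "z \<in> ?I"
    then obtain i j where z: "z = (i, j)" "i < m" "j < n" by auto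
    have "(\<Sum>w\<in>?I. of_int ((case z of (i, j) \<Rightarrow> \<lambda>(k, l). (if l = j then c i k else 0) + (if k = i then d j l else 0)) w) * b w)
        = (\<Sum>k<m. \<Sum>l<n. (if l = j then of_int (c i k) * x ^ k * y ^ l else 0)) +
          (\<Sum>k<m. \<Sum>l<n. (if k = i then of_int (d j l) * x ^ k * y ^ l else 0))"
      unfolding sum.cartesian_product sum.distrib[symmetric]
      by (intro sum.cong) (auto simp: z b_def algebra_simps)
    also have "(\<Sum>k<m. \<Sum>l<n. (if l = j then of_int (c i k) * x ^ k * y ^ l else 0))
        = (\<Sum>k<m. of_int (c i k) * x ^ k) * y ^ j"
      using z by (simp add: sum_distrib_right)
    also have "(\<Sum>k<m. \<Sum>l<n. (if k = i then of_int (d j l) * x ^ k * y ^ l else 0))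
        = (\<Sum>l<n. \<Sum>k<m. (if k = i then of_int (d j l) * x ^ k * y ^ l else 0))"
      by (rule sum.swap)
    also have "\<dots> = x ^ i * (\<Sum>l<n. of_int (d j l) * y ^ l)"
      using z by (simp add: sum_distrib_left mult_ac)
    finally have rhs: "(\<Sum>w\<in>?I. of_int ((case z of (i, j) \<Rightarrow> \<lambda>(k, l). (if l = j then c i k else 0) + (if k = i then d j l else 0)) w) * b w)
        = (x * x ^ i) * y ^ j + x ^ i * (y * y ^ j)"
      by (simp only: c[OF z(2)] d[OF z(3)])
    show "(x + y) * b z = (\<Sum>w\<in>?I. of_int ((case z of (i, j) \<Rightarrow> \<lambda>(k, l). (if l = j then c i k else 0) + (if k = i then d j l else 0)) w) * b w)"
      unfolding rhs by (simp add: z b_def algebra_simps)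
  qed
qed

lemma algebraic_int_diff:
  fixes x y :: complex
  shows "algebraic_int x \<Longrightarrow> algebraic_int y \<Longrightarrow> algebraic_int (x - y)"
  using algebraic_int_add[of x "- y"] by simp

lemma algebraic_int_sum:
  fixes f :: "'a \<Rightarrow> complex"
  shows "(\<And>i. i \<in> I \<Longrightarrow> algebraic_int (f i)) \<Longrightarrow> algebraic_int (sum f I)"
  by (induction I rule: infinite_finite_induct) (auto intro: algebraic_int_add)

lemma algebraic_int_power:
  "algebraic_int (x::complex) \<Longrightarrow> algebraic_int (x ^ n)"
  by (induction n) (auto intro: algebraic_int_mult)

lemma algebraic_int_poly:
  fixes x :: complex
  assumes "\<And>i. algebraic_int (Polynomial.coeff p i)" "algebraic_int x"
  shows "algebraic_int (poly p x)"
  unfolding poly_altdef using assms by (intro algebraic_int_sum algebraic_int_mult algebraic_int_power)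

text \<open>
  If \<open>c\<close> is the leading coefficient of an integer polynomial of degree \<open>n\<close> with root \<open>x\<close>, then
  multiplying the equation by \<open>c ^ (n - 1)\<close> turns it into a monic equation for \<open>c * x\<close>.
\<close>
lemma algebraic_obtain_multiple:
  fixes x :: complex
  assumes "algebraic x"
  obtains N :: nat where "N > 0" "algebraic_int (of_nat N * x)"
proof -
  obtain p where p: "p \<noteq> (0 :: int poly)" "poly (map_poly of_int p) x = 0"
    using algebraicE'[OF assms] by metis
  define c where "c = Polynomial.lead_coeff p"
  have c: "c \<noteq> 0" using p by (simp add: c_def)
  define n where "n = Polynomial.degree p"
  have n: "n > 0"
  proof (rule ccontr)
    assume "\<not> n > 0"
    then obtain c where "p = [:c:]"
      unfolding n_def using degree_eq_zeroE by blast
    with p show False by (auto simp: map_poly_pCons)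
  qed
  \<comment> \<open>The companion matrix of that monic equation.\<close>
  define A where "A = (\<lambda>i k. if Suc i = n then - Polynomial.coeff p k * c ^ (n - 1 - k) else if k = Suc i then 1 else 0)"
  have "poly (map_poly of_int p) x = (\<Sum>k\<le>n. of_int (Polynomial.coeff p k) * x ^ k)"
    by (simp add: poly_altdef n_def)
  also have "\<dots> = of_int c * x ^ n + (\<Sum>k<n. of_int (Polynomial.coeff p k) * x ^ k)"
    by (simp add: n_def c_def lessThan_Suc_atMost[symmetric])
  finally have xn: "of_int c * x ^ n = - (\<Sum>k<n. of_int (Polynomial.coeff p k) * x ^ k)"
    using p(2) by (simp add: eq_neg_iff_add_eq_0)
  have cx: "algebraic_int (of_int c * x)"
  proof (rule algebraic_int_if_stable_lattice[where I = "{..<n}" and ?i0.0 = 0 and A = A and b = "\<lambda>i. (of_int c * x) ^ i"])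
    fix i assume "i \<in> {..<n}"
    hence i: "i < n" by simp
    show "of_int c * x * (of_int c * x) ^ i = (\<Sum>j<n. of_int (A i j) * (of_int c * x) ^ j)"
    proof (cases "Suc i = n")
      case True
      have "of_int c * x * (of_int c * x) ^ i = of_int c ^ i * (of_int c * x ^ n)"
        by (simp flip: True add: power_mult_distrib mult_ac)
      also have "\<dots> = (\<Sum>k<n. - (of_int (Polynomial.coeff p k) * (of_int c ^ i * x ^ k)))"
        unfolding xn by (simp add: sum_distrib_left sum_negf mult_ac)
      also have "\<dots> = (\<Sum>j<n. of_int (A i j) * (of_int c * x) ^ j)"
      proof (rule sum.cong)
        fix k assume "k \<in> {..<n}"
        hence "i = (n - 1 - k) + k" using True by auto
        hence "(of_int c :: complex) ^ i = of_int c ^ (n - 1 - k) * of_int c ^ k"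
          by (metis power_add)
        thus "- (of_int (Polynomial.coeff p k) * (of_int c ^ i * x ^ k)) = of_int (A i k) * (of_int c * x) ^ k"
          using True by (simp add: A_def power_mult_distrib)
      qed simp
      finally show ?thesis .
    next
      case False
      with i have "Suc i < n" by simp
      have "(\<Sum>k<n. of_int (A i k) * (of_int c * x) ^ k) = (\<Sum>k<n. if k = Suc i then (of_int c * x) ^ k else 0)"
        using False by (intro sum.cong) (auto simp: A_def)
      also have "\<dots> = (of_int c * x) ^ Suc i" using \<open>Suc i < n\<close> by simp
      finally show ?thesis by simp
    qed
  qed (use n in auto)
  show ?thesis
  proof (rule that[of "nat \<bar>c\<bar>"])
    have "of_nat (nat \<bar>c\<bar>) * x = (if c > 0 then of_int c * x else - (of_int c * x))"
      using c by simp
    thus "algebraic_int (of_nat (nat \<bar>c\<bar>) * x)"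
      using cx by (auto simp: of_nat_nat)
  qed (use c in simp)
qed

lemma algebraic_int_cancel_nat:
  fixes x :: complex
  assumes "algebraic_int (of_nat N * x)" "N > 0"
  shows "algebraic x"
proof -
  obtain p where p: "Polynomial.lead_coeff p = 1" "\<forall>i. Polynomial.coeff p i \<in> \<int>"
      "poly p (of_nat N * x) = 0"
    using assms(1) by (auto elim!: algebraic_int.cases)
  show ?thesis
  proof (rule algebraicI')
    show "poly (pcompose p [:0, of_nat N:]) x = 0" using p by (simp add: poly_pcompose mult.commute)
    show "pcompose p [:0, of_nat N:] \<noteq> 0"
      using p assms(2) by (auto simp: pcompose_eq_0_iff)
    have "Polynomial.coeff (pcompose p [:0, of_nat N:]) i \<in> \<int>" for i
      using p(2) by (intro coeff_pcompose_semiring_closed) (auto simp: coeff_pCons split: nat.splits)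
    thus "Polynomial.coeff (pcompose p [:0, of_nat N:]) i \<in> \<rat>" for i
      using Ints_subset_Rats by blast
  qed
qed

text \<open>Clearing denominators reduces the claim to algebraic integers.\<close>
lemma
  fixes x y :: complex
  assumes "algebraic x" "algebraic y"
  shows algebraic_add: "algebraic (x + y)" and algebraic_mult: "algebraic (x * y)"
proof -
  obtain M where M: "M > 0" "algebraic_int (of_nat M * x)"
    using algebraic_obtain_multiple[OF assms(1)] .
  obtain N where N: "N > 0" "algebraic_int (of_nat N * y)"
    using algebraic_obtain_multiple[OF assms(2)] .
  have "algebraic_int (of_nat N * (of_nat M * x) + of_nat M * (of_nat N * y))"
    using algebraic_int_add[OF algebraic_int_mult[OF algebraic_int_of_nat M(2)] algebraic_int_mult[OF algebraic_int_of_nat N(2)]] .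
  hence "algebraic_int (of_nat (M * N) * (x + y))" by (simp add: algebra_simps)
  thus "algebraic (x + y)" using algebraic_int_cancel_nat M N by (metis nat_0_less_mult_iff)
  have "algebraic_int ((of_nat M * x) * (of_nat N * y))"
    by (rule algebraic_int_mult[OF M(2) N(2)])
  hence "algebraic_int (of_nat (M * N) * (x * y))" by (simp add: algebra_simps)
  thus "algebraic (x * y)" using algebraic_int_cancel_nat M N by (metis nat_0_less_mult_iff)
qed

lemma countable_algebraic: "countable {x :: complex. algebraic x}"
proof (rule countable_subset)
  show "{x :: complex. algebraic x} \<subseteq> (\<Union>p\<in>UNIV - {0 :: int poly}. {x. poly (map_poly of_int p) x = 0})"
    by (auto elim!: algebraicE')
  have "countable (UNIV :: int poly set)"
    by (rule countable_subset[OF _ countable_image[of UNIV "Poly :: int list \<Rightarrow> int poly"]])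
      (auto intro: range_eqI[of _ _ "Polynomial.coeffs _"])
  hence "countable (UNIV - {0 :: int poly})" by (rule countable_subset[rotated]) simp
  thus "countable (\<Union>p\<in>UNIV - {0 :: int poly}. {x :: complex. poly (map_poly of_int p) x = 0})"
  proof (rule countable_UN)
    fix p :: "int poly" assume "p \<in> UNIV - {0}"
    thus "countable {x :: complex. poly (map_poly of_int p) x = 0}"
      by (intro countable_finite poly_roots_finite) simp
  qed
qed

section \<open>Subfields of the complex numbers and conjugates\<close>

text \<open>
  Subfields are sets closed under the operations of the type \<open>complex\<close>, so that polynomials over
  a subfield are polynomials over \<open>complex\<close> with coefficients in the set, and chains of subfields
  need no change of type.
\<close>
locale complex_subfield =
  fixes K :: "complex set"
  assumes one_mem: "1 \<in> K"
    and add_mem: "x \<in> K \<Longrightarrow> y \<in> K \<Longrightarrow> x + y \<in> K"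
    and uminus_mem: "x \<in> K \<Longrightarrow> - x \<in> K"
    and mult_mem: "x \<in> K \<Longrightarrow> y \<in> K \<Longrightarrow> x * y \<in> K"
    and inverse_mem: "x \<in> K \<Longrightarrow> x \<noteq> 0 \<Longrightarrow> inverse x \<in> K"

definition poly_over :: "complex set \<Rightarrow> complex poly \<Rightarrow> bool" where
  "poly_over K p \<longleftrightarrow> (\<forall>i. Polynomial.coeff p i \<in> K)"

text \<open>
  For algebraic \<open>x\<close>, this says that \<open>y\<close> is a root of the minimal polynomial of \<open>x\<close> over \<open>K\<close>; in
  general it says that evaluation at \<open>y\<close> factors through evaluation at \<open>x\<close>.
\<close>
definition conjugate_over :: "complex set \<Rightarrow> complex \<Rightarrow> complex \<Rightarrow> bool" where
  "conjugate_over K x y \<longleftrightarrow> (\<forall>p. poly_over K p \<longrightarrow> poly p x = 0 \<longrightarrow> poly p y = 0)"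

context complex_subfield
begin

lemma zero_mem: "0 \<in> K"
  using add_mem[OF one_mem uminus_mem[OF one_mem]] by simp

lemma diff_mem: "x \<in> K \<Longrightarrow> y \<in> K \<Longrightarrow> x - y \<in> K"
  using add_mem[of x "- y"] uminus_mem[of y] by simp

lemma of_nat_mem: "of_nat n \<in> K"
  by (induction n) (auto intro: zero_mem add_mem one_mem)

lemma of_int_mem: "of_int n \<in> K"
  by (cases n) (auto simp del: of_nat_Suc intro: of_nat_mem uminus_mem)

lemma divide_mem: "x \<in> K \<Longrightarrow> y \<in> K \<Longrightarrow> x / y \<in> K"
  using mult_mem[OF _ inverse_mem, of x y] zero_mem by (cases "y = 0") (auto simp: field_simps)

lemma Rats_subset: "\<rat> \<subseteq> K"
  by (auto elim: Rats_cases' intro: divide_mem of_int_mem)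

lemma of_rat_mem: "of_rat q \<in> K"
  using Rats_subset by (auto simp: Rats_def)

lemma power_mem: "x \<in> K \<Longrightarrow> x ^ n \<in> K"
  by (induction n) (auto intro: one_mem mult_mem)

lemma sum_mem: "(\<And>i. i \<in> I \<Longrightarrow> f i \<in> K) \<Longrightarrow> sum f I \<in> K"
  by (induction I rule: infinite_finite_induct) (auto intro: zero_mem add_mem)

lemma poly_mem: "poly_over K p \<Longrightarrow> x \<in> K \<Longrightarrow> poly p x \<in> K"
  unfolding poly_altdef by (auto simp: poly_over_def intro!: sum_mem mult_mem power_mem)

lemma poly_over_mult: "poly_over K p \<Longrightarrow> poly_over K q \<Longrightarrow> poly_over K (p * q)"
  by (auto simp: poly_over_def coeff_mult intro!: sum_mem mult_mem)

lemma poly_over_add: "poly_over K p \<Longrightarrow> poly_over K q \<Longrightarrow> poly_over K (p + q)"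
  by (auto simp: poly_over_def intro!: add_mem)

lemma poly_over_diff: "poly_over K p \<Longrightarrow> poly_over K q \<Longrightarrow> poly_over K (p - q)"
  by (auto simp: poly_over_def intro!: diff_mem)

lemma poly_over_monom: "a \<in> K \<Longrightarrow> poly_over K (Polynomial.monom a n)"
  by (auto simp: poly_over_def zero_mem)

lemma poly_over_pCons: "a \<in> K \<Longrightarrow> poly_over K p \<Longrightarrow> poly_over K (pCons a p)"
  by (auto simp: poly_over_def coeff_pCons split: nat.splits)

lemma poly_over_0: "poly_over K 0"
  by (auto simp: poly_over_def zero_mem)

lemma poly_over_pderiv: "poly_over K p \<Longrightarrow> poly_over K (pderiv p)"
  by (auto simp: poly_over_def coeff_pderiv simp del: of_nat_Suc intro!: mult_mem of_nat_mem)

lemma poly_over_pcompose: "poly_over K p \<Longrightarrow> poly_over K q \<Longrightarrow> poly_over K (pcompose p q)"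
  unfolding poly_over_def by (intro allI coeff_pcompose_semiring_closed) (auto intro: zero_mem add_mem mult_mem)

lemma poly_over_rat: "(\<And>i. Polynomial.coeff p i \<in> \<rat>) \<Longrightarrow> poly_over K p"
  using Rats_subset by (auto simp: poly_over_def)

text \<open>
  A nonzero polynomial over \<open>K\<close> of least degree among those that vanish at \<open>x\<close> divides all the
  others, by division with remainder.
\<close>
lemma minimal_polynomial:
  assumes "algebraic x"
  obtains g where "poly_over K g" "Polynomial.lead_coeff g = 1" "poly g x = 0"
    and "\<And>q. poly_over K q \<Longrightarrow> poly q x = 0 \<Longrightarrow> g dvd q"
proof -
  define P where "P = (\<lambda>q. poly_over K q \<and> q \<noteq> 0 \<and> poly q x = 0)"
  obtain p where "P p"
    using assms unfolding algebraic_altdef P_def by (blast intro: poly_over_rat)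
  define f where "f = (ARG_MIN Polynomial.degree q. P q)"
  have f: "P f" and f_min: "\<And>q. P q \<Longrightarrow> Polynomial.degree f \<le> Polynomial.degree q"
    using arg_min_nat_lemma[of P p Polynomial.degree] \<open>P p\<close> unfolding f_def by auto
  define g where "g = Polynomial.smult (inverse (Polynomial.lead_coeff f)) f"
  have lf: "Polynomial.lead_coeff f \<noteq> 0" using f by (simp add: P_def)
  have g: "poly_over K g" "Polynomial.lead_coeff g = 1" "poly g x = 0"
    using f lf unfolding g_def P_def
    by (auto intro!: mult_mem inverse_mem simp: poly_over_def)
  have deg_g: "Polynomial.degree g = Polynomial.degree f" using lf by (simp add: g_def)
  have "g dvd q" if "poly_over K q" "poly q x = 0" for q
    using that
  proof (induction "Polynomial.degree q" arbitrary: q rule: less_induct)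
    case less
    show ?case
    proof (cases "q = 0")
      case False
      with less.prems have "P q" by (simp add: P_def)
      hence le: "Polynomial.degree g \<le> Polynomial.degree q" using f_min deg_g by simp
      \<comment> \<open>One step of the division: \<open>r * g\<close> has the leading term of \<open>q\<close>.\<close>
      define r where "r = Polynomial.monom (Polynomial.lead_coeff q) (Polynomial.degree q - Polynomial.degree g)"
      have dr: "Polynomial.degree (r * g) = Polynomial.degree q"
      proof -
        have "Polynomial.degree r = Polynomial.degree q - Polynomial.degree g"
          unfolding r_def by (rule Polynomial.degree_monom_eq) (use False in simp)
        moreover have "r \<noteq> 0" "g \<noteq> 0" using False g(2) by (auto simp: r_def)
        ultimately show ?thesis using le by (simp add: degree_mult_eq)
      qed
      have lr: "Polynomial.lead_coeff (r * g) = Polynomial.lead_coeff q"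
        unfolding lead_coeff_mult r_def using g(2) False by (simp add: Polynomial.degree_monom_eq)
      have "poly_over K r" unfolding r_def
        using less.prems(1) by (intro poly_over_monom) (simp add: poly_over_def)
      hence "poly_over K (q - r * g)" "poly (q - r * g) x = 0"
        using less.prems g by (auto intro!: poly_over_diff poly_over_mult)
      moreover have "Polynomial.degree (q - r * g) < Polynomial.degree q \<or> q - r * g = 0"
      proof (cases "Polynomial.degree q = 0")
        case True
        then obtain a b where "q = [:a:]" "r * g = [:b:]"
          using dr by (metis degree_eq_zeroE)
        then show ?thesis using lr by simp
      next
        case False
        have "Polynomial.coeff (q - r * g) (Polynomial.degree q) = 0"
          using lr dr by simp
        moreover have "Polynomial.degree (q - r * g) \<le> Polynomial.degree q"
          by (rule degree_diff_le) (use dr in auto)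
        ultimately show ?thesis
          using eq_zero_or_degree_less by blast
      qed
      ultimately have "g dvd q - r * g" using less.hyps by auto
      hence "g dvd (q - r * g) + r * g" by (intro dvd_add) auto
      thus ?thesis by simp
    qed simp
  qed
  thus ?thesis by (intro that[OF g])
qed

text \<open>
  The derivative of the minimal polynomial \<open>g\<close> has smaller degree, so it does not vanish at \<open>x\<close>,
  and \<open>x\<close> is a simple root of \<open>g\<close>.  Since \<open>x\<close> is not in \<open>K\<close>, the degree of \<open>g\<close> is at least \<open>2\<close>,
  so \<open>g\<close> has another root.
\<close>
lemma exists_conjugate:
  assumes "algebraic x" "x \<notin> K"
  obtains y where "y \<noteq> x" "conjugate_over K x y"
proof -
  obtain g where g: "poly_over K g" "Polynomial.lead_coeff g = 1" "poly g x = 0"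
      and dvd: "\<And>q. poly_over K q \<Longrightarrow> poly q x = 0 \<Longrightarrow> g dvd q"
    using minimal_polynomial[OF assms(1)] by metis
  obtain h where h: "g = [:-x, 1:] * h" using g(3) by (auto simp: poly_eq_0_iff_dvd)
  have "h \<noteq> 0" using g(2) h by auto
  hence dg: "Polynomial.degree g = Suc (Polynomial.degree h)"
    unfolding h by (subst degree_mult_eq) auto
  have "\<not> g dvd pderiv g"
    using dg dvd_imp_degree_le[of g "pderiv g"] by (auto simp: degree_pderiv pderiv_eq_0_iff)
  hence "poly (pderiv g) x \<noteq> 0" using dvd g(1) poly_over_pderiv by blast
  hence hx: "poly h x \<noteq> 0" unfolding h pderiv_mult by (simp add: pderiv_pCons)
  have "Polynomial.degree h \<noteq> 0"
  proof
    assume "Polynomial.degree h = 0"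
    then obtain c where c: "h = [:c:]" by (rule degree_eq_zeroE)
    have "c = 1" using g(2) c \<open>h \<noteq> 0\<close> by (simp add: h)
    hence "Polynomial.coeff g 0 = - x" by (simp add: h c)
    hence "- x \<in> K" using g(1) by (metis poly_over_def)
    thus False using uminus_mem[of "- x"] assms(2) by simp
  qed
  then obtain y where y: "poly h y = 0"
    using fundamental_theorem_of_algebra[of h] constant_degree[of h] by auto
  show ?thesis
  proof (rule that)
    show "y \<noteq> x" using y hx by auto
    have "poly g y = 0" using y by (simp add: h)
    thus "conjugate_over K x y"
      using dvd unfolding conjugate_over_def by (metis dvdE mult_zero_left poly_mult)
  qed
qed

text \<open>
  A monic integer equation for \<open>(x - t) / m\<close> is a polynomial equation for \<open>x\<close> with coefficients
  in \<open>K\<close>, so every conjugate of \<open>x\<close> satisfies it too.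
\<close>
lemma conjugate_affine_algebraic_int:
  assumes conj: "conjugate_over K x y" and "t \<in> K" "m \<in> K" and "algebraic_int ((x - t) / m)"
  shows "algebraic_int ((y - t) / m)"
proof -
  obtain h where h: "Polynomial.lead_coeff h = 1" "\<forall>i. Polynomial.coeff h i \<in> \<int>"
      "poly h ((x - t) / m) = 0"
    using assms(4) by (auto elim!: algebraic_int.cases)
  define q where "q = pcompose h [:- t / m, 1 / m:]"
  have ev: "poly q z = poly h ((z - t) / m)" for z
    by (simp add: q_def poly_pcompose diff_divide_distrib)
  have "poly_over K q" unfolding q_def
    using h(2) Ints_subset_Rats assms
    by (intro poly_over_pcompose poly_over_rat poly_over_pCons poly_over_0 divide_mem uminus_mem one_mem) auto
  hence "poly q y = 0" using conj h(3) unfolding conjugate_over_def ev[symmetric] by blast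
  thus ?thesis using h unfolding ev by (intro algebraic_int.intros)
qed

lemma conjugate_algebraic_int:
  "conjugate_over K x y \<Longrightarrow> algebraic_int x \<Longrightarrow> algebraic_int y"
  using conjugate_affine_algebraic_int[of x y 0 1] by (simp add: zero_mem one_mem)

end

section \<open>Congruences that separate a number from a subfield\<close>

text \<open>
  Cancelling powers of \<open>x\<close> in a monic integer equation for \<open>x\<close> leaves one with nonzero constant
  term, and all its other terms are divisible by \<open>x\<close>.
\<close>
lemma algebraic_int_dvd_int:
  fixes x :: complex
  assumes "algebraic_int x" "x \<noteq> 0"
  obtains y :: complex and e :: int where "algebraic_int y" "e \<noteq> 0" "x * y = of_int e"
proof -
  obtain p where p: "poly (map_poly of_int p) x = 0" "Polynomial.lead_coeff p = (1::int)"
    using assms unfolding algebraic_int_altdef_ipoly by blast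
  have "\<exists>y e. algebraic_int y \<and> e \<noteq> 0 \<and> x * y = of_int e"
    using p
  proof (induction p)
    case (pCons c p)
    show ?case
    proof (cases "c = 0")
      case True
      with pCons assms show ?thesis by (auto simp: map_poly_pCons split: if_splits)
    next
      case False
      have "algebraic_int (poly (map_poly of_int p) x)"
        using assms by (intro algebraic_int_poly) (auto simp: coeff_map_poly)
      moreover have "x * poly (map_poly of_int p) x = of_int (- c)"
        using pCons.prems(1) by (simp add: of_int_hom.map_poly_pCons_hom add_eq_0_iff)
      ultimately show ?thesis using False by (metis neg_equal_0_iff_equal)
    qed
  qed auto
  thus ?thesis using that by blast
qed

text \<open>
  Let \<open>y \<noteq> x\<close> be a conjugate of \<open>x\<close> over \<open>K\<close>, and let the algebraic integer \<open>x - y\<close> divide the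
  nonzero integer \<open>e\<close>.  If \<open>x = t + m r\<close>, then \<open>(x - y) / m\<close> is an algebraic integer,
  because it is the difference of \<open>r\<close> and a conjugate of \<open>r\<close>.  Hence \<open>e / m\<close> is a rational algebraic
  integer, so \<open>m\<close> divides \<open>e\<close>.  Any \<open>c > \<bar>e\<bar>\<close> excludes this for the multiples \<open>m\<close> of \<open>c\<close>.
\<close>
lemma (in complex_subfield) exists_separating_modulus:
  assumes "algebraic_int x" "x \<notin> K"
  obtains c :: nat where "c > 0"
    and "\<And>m t r. c dvd m \<Longrightarrow> m > 0 \<Longrightarrow> t \<in> K \<Longrightarrow> algebraic_int r \<Longrightarrow> x \<noteq> t + of_nat m * r"
proof -
  obtain y where y: "y \<noteq> x" "conjugate_over K x y"
    using exists_conjugate[OF algebraic_int_imp_algebraic[OF assms(1)] assms(2)] .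
  have "algebraic_int (x - y)"
    using algebraic_int_diff[OF assms(1) conjugate_algebraic_int[OF y(2) assms(1)]] .
  then obtain z e where z: "algebraic_int z" "e \<noteq> 0" "(x - y) * z = of_int e"
    using algebraic_int_dvd_int[of "x - y"] y by auto
  define c where "c = Suc (nat \<bar>e\<bar>)"
  have "x \<noteq> t + of_nat m * r" if m: "c dvd m" "m > 0" and t: "t \<in> K" and r: "algebraic_int r" for m t r
  proof
    assume x: "x = t + of_nat m * r"
    define s where "s = (y - t) / of_nat m"
    have "algebraic_int s" unfolding s_def
      by (rule conjugate_affine_algebraic_int[OF y(2) t of_nat_mem]) (use x r m in auto)
    have "of_int e = of_nat m * ((r - s) * z)"
      using m by (simp add: z(3)[symmetric] x s_def field_simps)
    hence eq: "of_int e / of_nat m = (r - s) * z" using m by (simp add: field_simps)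
    have "algebraic_int (of_int e / of_nat m :: complex)"
      unfolding eq by (rule algebraic_int_mult[OF algebraic_int_diff[OF r \<open>algebraic_int s\<close>] z(1)])
    moreover have "(of_int e / of_nat m :: complex) \<in> \<rat>" by auto
    ultimately have "(of_int e / of_nat m :: complex) \<in> \<int>" by (rule rational_algebraic_int_is_int)
    then obtain k where k: "(of_int e / of_nat m :: complex) = of_int k" by (auto elim: Ints_cases)
    hence "(of_int e :: complex) = of_int (k * int m)" using m by (simp add: field_simps)
    hence "e = k * int m" by (simp only: of_int_eq_iff)
    hence "int m dvd e" by simp
    hence "m \<le> nat \<bar>e\<bar>" using dvd_imp_le_int[OF z(2), of "int m"] by linarith
    moreover have "c \<le> m" using m by (simp add: dvd_imp_le)
    ultimately show False by (simp add: c_def)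
  qed
  thus ?thesis using that[of c] by (simp add: c_def)
qed

text \<open>
  The property of a modulus is inherited by its multiples, so the product of the moduli of the
  single elements works for all of them.
\<close>
lemma exists_modulus_for_finite_set:
  assumes K: "complex_subfield K" and fin: "finite A" and A: "\<forall>x\<in>A. algebraic_int x \<and> x \<notin> K"
  shows "\<exists>c::nat. c > 0 \<and> (\<forall>x\<in>A. \<forall>m t r. c dvd m \<longrightarrow> m > 0 \<longrightarrow> t \<in> K \<longrightarrow> algebraic_int r \<longrightarrow>
    x \<noteq> t + of_nat m * r)"
proof -
  interpret complex_subfield K by (rule K)
  have "\<forall>x\<in>A. \<exists>c::nat. c > 0 \<and> (\<forall>m t r. c dvd m \<longrightarrow> m > 0 \<longrightarrow> t \<in> K \<longrightarrow> algebraic_int r \<longrightarrow> x \<noteq> t + of_nat m * r)"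
    using A exists_separating_modulus by metis
  then obtain c :: "complex \<Rightarrow> nat" where c: "\<And>x. x \<in> A \<Longrightarrow> c x > 0"
    "\<And>x m t r. x \<in> A \<Longrightarrow> c x dvd m \<Longrightarrow> m > 0 \<Longrightarrow> t \<in> K \<Longrightarrow> algebraic_int r \<Longrightarrow> x \<noteq> t + of_nat m * r"
    by metis
  show ?thesis
  proof (intro exI[of _ "prod c A"] conjI ballI allI impI)
    show "prod c A > 0" using c(1) by (auto intro: prod_pos)
    show "x \<noteq> t + of_nat m * r" if "x \<in> A" "prod c A dvd m" "m > 0" "t \<in> K" "algebraic_int r" for x m t r
      using c(2)[OF that(1) _ that(3-5)] dvd_prodI[OF fin that(1), of c] that(2) dvd_trans by blast
  qed
qed

text \<open>
  The algebraic integers that are congruent modulo \<open>m\<close> to an algebraic integer of \<open>K\<close>.  The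
  representative \<open>t\<close> has to be integral for the set to be closed under multiplication.
\<close>
definition congruence_ring :: "complex set \<Rightarrow> nat \<Rightarrow> complex set" where
  "congruence_ring K m = {t + of_nat m * r | t r. t \<in> K \<and> algebraic_int t \<and> algebraic_int r}"

lemma congruence_ring_closed:
  assumes "complex_subfield K"
  shows "1 \<in> congruence_ring K m"
    and "x \<in> congruence_ring K m \<Longrightarrow> - x \<in> congruence_ring K m"
    and "x \<in> congruence_ring K m \<Longrightarrow> y \<in> congruence_ring K m \<Longrightarrow> x + y \<in> congruence_ring K m"
    and "x \<in> congruence_ring K m \<Longrightarrow> y \<in> congruence_ring K m \<Longrightarrow> x * y \<in> congruence_ring K m"
proof -
  interpret complex_subfield K by (rule assms)
  have I: "t + of_nat m * r \<in> congruence_ring K m" if "t \<in> K" "algebraic_int t" "algebraic_int r" for t r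
    using that by (auto simp: congruence_ring_def)
  show "1 \<in> congruence_ring K m" using I[of 1 0] one_mem by simp
  show "- x \<in> congruence_ring K m" if x: "x \<in> congruence_ring K m"
  proof -
    obtain t r where x: "x = t + of_nat m * r" "t \<in> K" "algebraic_int t" "algebraic_int r"
      using x by (auto simp: congruence_ring_def)
    have "- x = - t + of_nat m * (- r)" by (simp add: x(1))
    also have "\<dots> \<in> congruence_ring K m" using x by (intro I uminus_mem) auto
    finally show ?thesis .
  qed
  assume "x \<in> congruence_ring K m" "y \<in> congruence_ring K m"
  then obtain t r s q where x: "x = t + of_nat m * r" "t \<in> K" "algebraic_int t" "algebraic_int r"
    and y: "y = s + of_nat m * q" "s \<in> K" "algebraic_int s" "algebraic_int q"
    by (auto simp: congruence_ring_def)
  have "x + y = (t + s) + of_nat m * (r + q)" by (simp add: x(1) y(1) algebra_simps)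
  also have "\<dots> \<in> congruence_ring K m"
    by (rule I[OF add_mem[OF x(2) y(2)] algebraic_int_add[OF x(3) y(3)] algebraic_int_add[OF x(4) y(4)]])
  finally show "x + y \<in> congruence_ring K m" .
  have "x * y = t * s + of_nat m * (t * q + r * s + of_nat m * (r * q))" by (simp add: x(1) y(1) algebra_simps)
  also have "\<dots> \<in> congruence_ring K m"
    by (rule I[OF mult_mem[OF x(2) y(2)] algebraic_int_mult[OF x(3) y(3)]
          algebraic_int_add[OF algebraic_int_add[OF algebraic_int_mult[OF x(3) y(4)] algebraic_int_mult[OF x(4) y(3)]]
            algebraic_int_mult[OF algebraic_int_of_nat algebraic_int_mult[OF x(4) y(4)]]]])
  finally show "x * y \<in> congruence_ring K m" .
qed

section \<open>Algebraic integers of bounded degree with bounded conjugates\<close>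

text \<open>
  Multiplication by \<open>X - z\<close> increases the sum of the absolute values of the coefficients at most
  by the factor \<open>1 + norm z\<close>.
\<close>
lemma poly_coeff_bound:
  fixes p :: "complex poly"
  assumes "Polynomial.lead_coeff p = 1" "\<And>z. poly p z = 0 \<Longrightarrow> norm z \<le> C"
  shows "(\<Sum>i\<le>Polynomial.degree p. norm (Polynomial.coeff p i)) \<le> (1 + C) ^ Polynomial.degree p"
  using assms
proof (induction "Polynomial.degree p" arbitrary: p)
  case 0
  then obtain c where "p = [:c:]" by (metis degree_eq_zeroE)
  with 0 show ?case by simp
next
  case (Suc n)
  have "\<not> constant (poly p)" using Suc.hyps(2) by (simp add: constant_degree)
  then obtain z where z: "poly p z = 0" using fundamental_theorem_of_algebra by blast
  then obtain q where q: "p = [:-z, 1:] * q" by (auto simp: poly_eq_0_iff_dvd)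
  have "q \<noteq> 0" using Suc.prems(1) q by auto
  hence dp: "Polynomial.degree p = Suc (Polynomial.degree q)"
    unfolding q by (subst degree_mult_eq) auto
  hence n: "n = Polynomial.degree q" using Suc.hyps(2) by simp
  have lq: "Polynomial.lead_coeff q = 1"
    using Suc.prems(1) unfolding q lead_coeff_mult by simp
  have IH: "(\<Sum>i\<le>n. norm (Polynomial.coeff q i)) \<le> (1 + C) ^ n"
    unfolding n by (rule Suc.hyps(1)[OF n lq]) (use Suc.prems(2) q in auto)
  have zC: "norm z \<le> C" by (rule Suc.prems(2)[OF z])
  have "(\<Sum>i\<le>Suc n. norm (Polynomial.coeff p i))
      \<le> (\<Sum>i\<le>Suc n. norm z * norm (Polynomial.coeff q i) + (case i of 0 \<Rightarrow> 0 | Suc j \<Rightarrow> norm (Polynomial.coeff q j)))"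
  proof (rule sum_mono)
    fix i
    have "Polynomial.coeff p i = - z * Polynomial.coeff q i + (case i of 0 \<Rightarrow> 0 | Suc j \<Rightarrow> Polynomial.coeff q j)"
      by (simp add: q coeff_pCons split: nat.splits)
    thus "norm (Polynomial.coeff p i) \<le> norm z * norm (Polynomial.coeff q i) + (case i of 0 \<Rightarrow> 0 | Suc j \<Rightarrow> norm (Polynomial.coeff q j))"
      by (auto simp: norm_mult split: nat.splits intro: order_trans[OF norm_triangle_ineq4])
  qed
  also have "\<dots> = norm z * (\<Sum>i\<le>n. norm (Polynomial.coeff q i)) + (\<Sum>i\<le>n. norm (Polynomial.coeff q i))"
  proof -
    have "Polynomial.coeff q (Suc n) = 0" by (rule coeff_eq_0) (simp add: n)
    hence "(\<Sum>i\<le>Suc n. norm (Polynomial.coeff q i)) = (\<Sum>i\<le>n. norm (Polynomial.coeff q i))" by simp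
    thus ?thesis by (simp only: sum.distrib sum_distrib_left[symmetric] sum.atMost_Suc_shift) simp
  qed
  also have "\<dots> = (1 + norm z) * (\<Sum>i\<le>n. norm (Polynomial.coeff q i))" by (simp add: algebra_simps)
  also have "\<dots> \<le> (1 + C) * (1 + C) ^ n"
    using IH zC order_trans[OF norm_ge_zero zC] by (intro mult_mono) (auto intro: sum_nonneg)
  finally show ?case unfolding Suc.hyps(2)[symmetric] by simp
qed

text \<open>The coefficients of a monic polynomial are sums of products of its roots, up to sign.\<close>
lemma coeff_algebraic_int_if_roots:
  fixes p :: "complex poly"
  assumes "Polynomial.lead_coeff p = 1" "\<And>z. poly p z = 0 \<Longrightarrow> algebraic_int z"
  shows "algebraic_int (Polynomial.coeff p i)"
  using assms
proof (induction "Polynomial.degree p" arbitrary: p i)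
  case 0
  then obtain c where "p = [:c:]" by (metis degree_eq_zeroE)
  with 0 show ?case by (simp add: coeff_pCons split: nat.splits)
next
  case (Suc n)
  have "\<not> constant (poly p)" using Suc.hyps(2) by (simp add: constant_degree)
  then obtain z where z: "poly p z = 0" using fundamental_theorem_of_algebra by blast
  then obtain q where q: "p = [:-z, 1:] * q" by (auto simp: poly_eq_0_iff_dvd)
  have "q \<noteq> 0" using Suc.prems(1) q by auto
  hence dp: "Polynomial.degree p = Suc (Polynomial.degree q)"
    unfolding q by (subst degree_mult_eq) auto
  hence n: "n = Polynomial.degree q" using Suc.hyps(2) by simp
  have lq: "Polynomial.lead_coeff q = 1"
    using Suc.prems(1) unfolding q lead_coeff_mult by simp
  have IH: "algebraic_int (Polynomial.coeff q j)" for j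
    by (rule Suc.hyps(1)[OF n lq]) (use Suc.prems(2) q in auto)
  have "Polynomial.coeff p i = (case i of 0 \<Rightarrow> 0 | Suc j \<Rightarrow> Polynomial.coeff q j) - z * Polynomial.coeff q i"
    by (simp add: q coeff_pCons split: nat.splits)
  moreover have "algebraic_int (case i of 0 \<Rightarrow> 0 | Suc j \<Rightarrow> Polynomial.coeff q j)"
    using IH by (cases i) auto
  ultimately show ?case
    using algebraic_int_diff[OF _ algebraic_int_mult[OF Suc.prems(2)[OF z] IH]] by simp
qed

lemma finite_bounded_int_polys: "finite {p :: int poly. Polynomial.degree p \<le> n \<and> (\<forall>i. \<bar>Polynomial.coeff p i\<bar> \<le> B)}"
proof (rule finite_subset)
  show "{p :: int poly. Polynomial.degree p \<le> n \<and> (\<forall>i. \<bar>Polynomial.coeff p i\<bar> \<le> B)}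
     \<subseteq> Poly ` {xs. set xs \<subseteq> {-B..B} \<and> length xs = Suc n}"
  proof
    fix p :: "int poly" assume p: "p \<in> {p. Polynomial.degree p \<le> n \<and> (\<forall>i. \<bar>Polynomial.coeff p i\<bar> \<le> B)}"
    define xs where "xs = map (Polynomial.coeff p) [0..<Suc n]"
    have "Polynomial.coeff (Poly xs) i = Polynomial.coeff p i" for i
      using p by (auto simp: xs_def nth_default_def coeff_eq_0 simp del: upt_Suc)
    hence "p = Poly xs" by (simp add: poly_eq_iff)
    moreover have "set xs \<subseteq> {-B..B}" using p by (auto simp: xs_def abs_le_iff minus_le_iff)
    ultimately show "p \<in> Poly ` {xs. set xs \<subseteq> {-B..B} \<and> length xs = Suc n}"
      by (auto simp: xs_def simp del: upt_Suc)
  qed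
qed (intro finite_imageI finite_lists_length_eq, simp)

lemma complex_subfield_Rats: "complex_subfield \<rat>"
  by unfold_locales auto

definition algebraic_degree_le :: "nat \<Rightarrow> complex \<Rightarrow> bool" where
  "algebraic_degree_le n x \<longleftrightarrow> (\<exists>p. p \<noteq> 0 \<and> poly_over \<rat> p \<and> poly p x = 0 \<and> Polynomial.degree p \<le> n)"

text \<open>
  The minimal polynomial of \<open>x\<close> over the rationals has degree at most \<open>n\<close>, its roots are bounded
  algebraic integers, and so its coefficients are integers of bounded size.
\<close>
lemma finite_bounded_algebraic_ints:
  "finite {x. algebraic_int x \<and> algebraic_degree_le n x \<and> (\<forall>y. conjugate_over \<rat> x y \<longrightarrow> norm y \<le> C)}"
proof (rule finite_subset)
  interpret complex_subfield \<rat> by (rule complex_subfield_Rats)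
  define B where "B = \<lfloor>(1 + \<bar>C\<bar>) ^ n\<rfloor>"
  define PP where "PP = {p :: int poly. Polynomial.degree p \<le> n \<and> (\<forall>i. \<bar>Polynomial.coeff p i\<bar> \<le> B)}"
  show "finite (\<Union>p\<in>PP - {0}. {x :: complex. poly (map_poly of_int p) x = 0})"
    using finite_bounded_int_polys[of n B] by (intro finite_UN_I poly_roots_finite) (auto simp: PP_def)
  show "{x. algebraic_int x \<and> algebraic_degree_le n x \<and> (\<forall>y. conjugate_over \<rat> x y \<longrightarrow> norm y \<le> C)}
      \<subseteq> (\<Union>p\<in>PP - {0}. {x :: complex. poly (map_poly of_int p) x = 0})"
  proof
    fix x assume "x \<in> {x. algebraic_int x \<and> algebraic_degree_le n x \<and> (\<forall>y. conjugate_over \<rat> x y \<longrightarrow> norm y \<le> C)}"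
    hence x: "algebraic_int x" "algebraic_degree_le n x" and C: "\<And>y. conjugate_over \<rat> x y \<Longrightarrow> norm y \<le> C" by auto
    obtain g where g: "poly_over \<rat> g" "Polynomial.lead_coeff g = 1" "poly g x = 0"
      and dvd: "\<And>q. poly_over \<rat> q \<Longrightarrow> poly q x = 0 \<Longrightarrow> g dvd q"
      using minimal_polynomial[OF algebraic_int_imp_algebraic[OF x(1)]] by metis
    have conj: "conjugate_over \<rat> x y" if "poly g y = 0" for y
      using that dvd unfolding conjugate_over_def by (metis dvdE mult_zero_left poly_mult)
    have deg: "Polynomial.degree g \<le> n"
    proof -
      obtain p where p: "p \<noteq> 0" "poly_over \<rat> p" "poly p x = 0" "Polynomial.degree p \<le> n"
        using x(2) by (auto simp: algebraic_degree_le_def)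
      have "Polynomial.degree g \<le> Polynomial.degree p"
        using dvd[OF p(2,3)] p(1) by (rule dvd_imp_degree_le)
      with p(4) show ?thesis by simp
    qed
    have "C \<ge> 0" using C[of x] order_trans[OF norm_ge_zero] by (auto simp: conjugate_over_def)
    have bound: "norm (Polynomial.coeff g i) \<le> (1 + \<bar>C\<bar>) ^ n" for i
    proof (cases "i \<le> Polynomial.degree g")
      case True
      have "norm (Polynomial.coeff g i) \<le> (\<Sum>i\<le>Polynomial.degree g. norm (Polynomial.coeff g i))"
        using True by (intro member_le_sum) auto
      also have "\<dots> \<le> (1 + C) ^ Polynomial.degree g"
        using poly_coeff_bound[OF g(2)] C conj by blast
      also have "\<dots> \<le> (1 + C) ^ n" using deg \<open>C \<ge> 0\<close> by (intro power_increasing) auto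
      finally show ?thesis using \<open>C \<ge> 0\<close> by simp
    qed (auto simp: coeff_eq_0)
    have int: "Polynomial.coeff g i \<in> \<int>" for i
    proof (rule rational_algebraic_int_is_int)
      show "Polynomial.coeff g i \<in> \<rat>" using g(1) by (simp add: poly_over_def)
      show "algebraic_int (Polynomial.coeff g i)"
        using coeff_algebraic_int_if_roots[OF g(2)] conj conjugate_algebraic_int x(1) by blast
    qed
    then obtain p where p: "g = map_poly of_int p" by (erule intpolyE)
    have "\<bar>Polynomial.coeff p i\<bar> \<le> B" for i
      using bound[of i] unfolding B_def by (simp add: p coeff_map_poly le_floor_iff)
    moreover have "Polynomial.degree p \<le> n" "p \<noteq> 0" using deg g(2) by (auto simp: p)
    ultimately show "x \<in> (\<Union>p\<in>PP - {0}. {x :: complex. poly (map_poly of_int p) x = 0})"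
      using g(3) by (auto simp: PP_def p)
  qed
qed

section \<open>The field of algebraic numbers and its finite subextensions\<close>

lemma Qbar_simps [simp]:
  "carrier Qbar = {z. algebraic z}" "monoid.mult Qbar = (*)" "monoid.one Qbar = 1"
  "ring.zero Qbar = 0" "ring.add Qbar = (+)"
  by (simp_all add: Qbar_def ring_of_type_algebra_def)

lemma field_Qbar: "Ring.field Qbar"
proof -
  have inv: "\<exists>y. algebraic y \<and> x + y = 0" if "algebraic x" for x :: complex
    using that by (intro exI[of _ "- x"]) auto
  have minv: "\<exists>y. algebraic y \<and> x * y = 1" if "algebraic x" "x \<noteq> 0" for x :: complex
    using that by (intro exI[of _ "inverse x"]) auto
  show ?thesis
    by unfold_locales
      (auto simp: Units_def algebraic_add algebraic_mult algebra_simps inv minv dest: minv intro: inv)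
qed

lemma Qbar_a_inv: "algebraic x \<Longrightarrow> a_inv Qbar x = - x"
proof -
  interpret Qbar: Ring.field Qbar by (rule field_Qbar)
  show "algebraic x \<Longrightarrow> a_inv Qbar x = - x"
    by (rule Qbar.minus_equality) auto
qed

lemma Qbar_m_inv: "algebraic x \<Longrightarrow> x \<noteq> 0 \<Longrightarrow> m_inv Qbar x = inverse x"
proof -
  interpret Qbar: Ring.field Qbar by (rule field_Qbar)
  show "algebraic x \<Longrightarrow> x \<noteq> 0 \<Longrightarrow> m_inv Qbar x = inverse x"
    by (rule Qbar.inv_char) auto
qed

lemma Qbar_pow: "x [^]\<^bsub>Qbar\<^esub> (n::nat) = x ^ n"
  by (induction n) auto

lemma subfield_Qbar_imp_complex_subfield:
  assumes "subfield K Qbar"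
  shows "complex_subfield K"
proof -
  interpret Qbar: Ring.field Qbar by (rule field_Qbar)
  note sub = subringE[OF subfieldE(1)[OF assms]]
  have alg: "algebraic x" if "x \<in> K" for x using sub(1) that by auto
  show ?thesis
  proof
    show "1 \<in> K" using sub(3) by simp
    show "- x \<in> K" if "x \<in> K" for x using sub(5)[OF that] that by (simp add: Qbar_a_inv alg)
    show "x + y \<in> K" "x * y \<in> K" if "x \<in> K" "y \<in> K" for x y
      using sub(6,7)[OF that] by simp_all
    show "inverse x \<in> K" if "x \<in> K" "x \<noteq> 0" for x
      using Qbar.subfield_m_inv(1)[OF assms, of x] that by (simp add: Qbar_m_inv alg)
  qed
qed

lemma subring_QbarI:
  assumes "\<And>x. x \<in> T \<Longrightarrow> algebraic x" "1 \<in> T" "\<And>x. x \<in> T \<Longrightarrow> - x \<in> T"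
    "\<And>x y. x \<in> T \<Longrightarrow> y \<in> T \<Longrightarrow> x * y \<in> T" "\<And>x y. x \<in> T \<Longrightarrow> y \<in> T \<Longrightarrow> x + y \<in> T"
  shows "subring T Qbar"
proof -
  interpret Qbar: Ring.field Qbar by (rule field_Qbar)
  show ?thesis using assms by (intro Qbar.subringI) (auto simp: Qbar_a_inv)
qed

lemma subring_QbarD:
  assumes "subring S Qbar"
  shows "\<And>x. x \<in> S \<Longrightarrow> algebraic x" "0 \<in> S" "1 \<in> S" "\<And>x. x \<in> S \<Longrightarrow> - x \<in> S"
    "\<And>x y. x \<in> S \<Longrightarrow> y \<in> S \<Longrightarrow> x * y \<in> S" "\<And>x y. x \<in> S \<Longrightarrow> y \<in> S \<Longrightarrow> x + y \<in> S"
proof -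
  note sub = subringE[OF assms]
  show alg: "algebraic x" if "x \<in> S" for x using sub(1) that by auto
  show "0 \<in> S" "1 \<in> S" using sub(2,3) by simp_all
  show "- x \<in> S" if "x \<in> S" for x using sub(5)[OF that] that by (simp add: Qbar_a_inv alg)
  show "x * y \<in> S" "x + y \<in> S" if "x \<in> S" "y \<in> S" for x y
    using sub(6,7)[OF that] by simp_all
qed

lemma subfield_Rats_Qbar: "subfield \<rat> Qbar"
proof -
  interpret Qbar: Ring.field Qbar by (rule field_Qbar)
  have "subring \<rat> Qbar" by (rule subring_QbarI) (auto intro: rat_imp_algebraic)
  thus ?thesis by (rule Qbar.subfieldI') (auto simp: Qbar_m_inv rat_imp_algebraic)
qed

text \<open>
  Polynomials over a ring structure are lists of coefficients with the leading coefficient first,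
  so they correspond to the reversed coefficient lists of the polynomials over a type.
\<close>
lemma Qbar_eval:
  assumes "set p \<subseteq> carrier Qbar" "algebraic x"
  shows "ring.eval Qbar p x = poly (Poly (rev p)) x"
proof -
  interpret Qbar: Ring.field Qbar by (rule field_Qbar)
  show ?thesis using assms
  proof (induction p)
    case (Cons a p)
    have "poly (Poly (rev p @ [a])) x = a * x ^ length p + poly (Poly (rev p)) x"
      by (simp add: Poly_append poly_monom)
    with Cons show ?case by (simp add: Qbar_pow)
  qed simp
qed

lemma algebraic_over_Rats:
  assumes "algebraic x"
  shows "(ring.algebraic Qbar over \<rat>) x"
proof -
  interpret Qbar: Ring.field Qbar by (rule field_Qbar)
  obtain p where p: "\<And>i. Polynomial.coeff p i \<in> \<rat>" "p \<noteq> 0" "poly p x = 0"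
    using assms unfolding algebraic_altdef by blast
  have sub: "set (rev (Polynomial.coeffs p)) \<subseteq> \<rat>" using p(1) by (auto simp: Polynomial.coeffs_def)
  show ?thesis
  proof (rule Qbar.algebraicI)
    show "rev (Polynomial.coeffs p) \<in> carrier (univ_poly Qbar \<rat>)"
      using sub p(2) by (simp add: univ_poly_def polynomial_def hd_rev last_coeffs_eq_coeff_degree)
    show "rev (Polynomial.coeffs p) \<noteq> []" using p(2) by simp
    show "Qbar.eval (rev (Polynomial.coeffs p)) x = ring.zero Qbar"
      using sub assms p(3) by (subst Qbar_eval) (auto intro: rat_imp_algebraic)
  qed
qed

text \<open>
  For algebraic \<open>x\<close> the polynomial expressions in \<open>x\<close> are already closed under inverses.
\<close>
lemma generate_field_singleton_poly:
  assumes "algebraic x" "y \<in> generate_field Qbar {x}"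
  obtains p where "poly_over \<rat> p" "y = poly p x"
proof -
  interpret Qbar: Ring.field Qbar by (rule field_Qbar)
  have x: "x \<in> carrier Qbar" using assms(1) by simp
  have "subfield (Qbar.simple_extension \<rat> x) Qbar"
    using Qbar.simple_extension_is_subfield[OF subfield_Rats_Qbar x] algebraic_over_Rats[OF assms(1)] by simp
  moreover have "x \<in> Qbar.simple_extension \<rat> x"
    by (rule Qbar.simple_extension_mem[OF subfieldE(1)[OF subfield_Rats_Qbar] x])
  ultimately have "generate_field Qbar {x} \<subseteq> Qbar.simple_extension \<rat> x"
    using Qbar.generate_field_min_subfield1[of "{x}"] x by auto
  also have "\<dots> = (\<lambda>p. Qbar.eval p x) ` carrier (univ_poly Qbar \<rat>)"
    by (rule Qbar.simple_extension_as_eval_img[OF subfieldE(3)[OF subfield_Rats_Qbar] x])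
  finally obtain q where q: "q \<in> carrier (univ_poly Qbar \<rat>)" "y = Qbar.eval q x"
    using assms(2) by auto
  have sub: "set q \<subseteq> \<rat>" using q(1) by (auto simp: univ_poly_def polynomial_def)
  show ?thesis
  proof (rule that)
    show "poly_over \<rat> (Poly (rev q))"
      using sub by (auto simp: poly_over_def nth_default_def rev_nth intro: subsetD[OF sub nth_mem])
    show "y = poly (Poly (rev q)) x"
      using q sub assms(1) by (auto simp: Qbar_eval rat_imp_algebraic subset_iff)
  qed
qed

lemma Qbar_combine:
  assumes "length Ks = length Us"
  shows "ring.combine Qbar Ks Us = (\<Sum>i<length Us. Ks ! i * Us ! i)"
proof -
  interpret Qbar: Ring.field Qbar by (rule field_Qbar)
  show ?thesis using assms
    by (induction Ks Us rule: list_induct2) (simp_all add: sum.lessThan_Suc_shift del: sum.lessThan_Suc)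
qed

text \<open>The \<open>n + 1\<close> powers \<open>1, x, \<dots>, x ^ n\<close> are linearly dependent over the rationals.\<close>
lemma algebraic_degree_le_dimension:
  assumes "ring.dimension Qbar n \<rat> F" "subring F Qbar" "x \<in> F"
  shows "algebraic_degree_le n x"
proof -
  interpret Qbar: Ring.field Qbar by (rule field_Qbar)
  define Us where "Us = map (\<lambda>i. x ^ i) [0..<Suc n]"
  have pow: "x ^ i \<in> F" for i
    using subring_QbarD(3,5)[OF assms(2)] assms(3) by (induction i) auto
  have Us: "set Us \<subseteq> F" using pow by (auto simp: Us_def simp del: upt_Suc)
  hence Us': "set Us \<subseteq> carrier Qbar" using subring_QbarD(1)[OF assms(2)] by auto
  have "\<not> Qbar.independent \<rat> Us"
    using Qbar.independent_length_le_dimension[OF subfield_Rats_Qbar assms(1) _ Us]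
    by (auto simp: Us_def simp del: upt_Suc)
  then obtain Ks where Ks: "length Ks = length Us" "Qbar.combine Ks Us = 0" "set Ks \<subseteq> \<rat>" "set Ks \<noteq> {0}"
    using Qbar.dependent_imp_non_trivial_combine[OF subfield_Rats_Qbar Us'] by auto
  have len: "length Us = Suc n" by (simp add: Us_def)
  have coeff: "Polynomial.coeff (Poly Ks) i = (if i < Suc n then Ks ! i else 0)" for i
    using Ks(1) len by (simp add: nth_default_def)
  have deg: "Polynomial.degree (Poly Ks) \<le> n"
    by (rule Polynomial.degree_le) (use Ks(1) len in \<open>auto simp: nth_default_def\<close>)
  show ?thesis unfolding algebraic_degree_le_def
  proof (intro exI conjI)
    show "Poly Ks \<noteq> 0"
    proof
      assume "Poly Ks = 0"
      hence z: "Ks ! i = 0" if "i < Suc n" for i using coeff[of i] that by simp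
      hence "set Ks \<subseteq> {0}" using Ks(1) len by (auto simp: in_set_conv_nth)
      moreover have "Ks ! 0 \<in> set Ks" using Ks(1) len by (intro nth_mem) simp
      ultimately show False using Ks(4) by auto
    qed
    show "poly_over \<rat> (Poly Ks)"
      using Ks(1,3) len by (auto simp: poly_over_def nth_default_def intro: subsetD[OF Ks(3) nth_mem])
    have "poly (Poly Ks) x = (\<Sum>i\<le>n. Polynomial.coeff (Poly Ks) i * x ^ i)"
      unfolding poly_altdef using deg
      by (intro sum.mono_neutral_left) (auto simp del: coeff_Poly_eq intro: le_degree)
    also have "\<dots> = (\<Sum>i<Suc n. Ks ! i * Us ! i)"
      using Ks(1) len by (intro sum.cong) (auto simp: nth_default_def Us_def simp del: upt_Suc)
    also have "\<dots> = 0" using Ks(1,2) len by (simp add: Qbar_combine)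
    finally show "poly (Poly Ks) x = 0" .
    show "Polynomial.degree (Poly Ks) \<le> n" by (rule deg)
  qed
qed

text \<open>
  The field generated by finitely many algebraic numbers lies in a subfield \<open>F\<close> of finite
  dimension \<open>n\<close> over the rationals, and \<open>F\<close> contains all the fields generated by one of its elements.
  The value of \<open>global_degree\<close> is given by a description, so its bounds require that the
  dimension of these fields exists.
\<close>
lemma finitely_generated_field_bounds:
  assumes "finite A" "\<And>x. x \<in> A \<Longrightarrow> algebraic x"
  obtains n where "\<And>x. x \<in> generate_field Qbar A \<Longrightarrow> algebraic_degree_le n x"
    and "\<And>x. x \<in> generate_field Qbar A \<Longrightarrow> 0 < global_degree (generate_field Qbar {x}) \<and> global_degree (generate_field Qbar {x}) \<le> n"
proof -
  interpret Qbar: Ring.field Qbar by (rule field_Qbar)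
  obtain xs where xs: "set xs = A" using finite_list[OF assms(1)] by blast
  define F where "F = Qbar.finite_extension \<rat> xs"
  have xs': "set xs \<subseteq> carrier Qbar" using assms(2) xs by auto
  have ov: "(Qbar.algebraic over \<rat>) x" if "x \<in> set xs" for x
    using algebraic_over_Rats assms(2) xs that by blast
  have F: "subfield F Qbar" unfolding F_def
    by (rule Qbar.finite_extension_is_subfield[OF subfield_Rats_Qbar xs' ov])
  have fin: "Qbar.finite_dimension \<rat> F" unfolding F_def
    by (rule Qbar.finite_extension_finite_dimension(1)[OF subfield_Rats_Qbar xs' ov])
  then obtain n where n: "Qbar.dimension n \<rat> F" by (auto simp: Qbar.finite_dimension_def)
  have "A \<subseteq> F" unfolding F_def xs[symmetric]
    by (rule Qbar.finite_extension_mem[OF subfieldE(1)[OF subfield_Rats_Qbar] xs'])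
  hence sub: "generate_field Qbar A \<subseteq> F"
    by (intro Qbar.generate_field_min_subfield1) (use F assms(2) in auto)
  show ?thesis
  proof (rule that[of n])
    fix x assume x: "x \<in> generate_field Qbar A"
    show "algebraic_degree_le n x"
      using algebraic_degree_le_dimension[OF n subfieldE(1)[OF F]] sub x by blast
    define K where "K = generate_field Qbar {x}"
    have xF: "x \<in> F" using x sub by blast
    have x': "{x} \<subseteq> carrier Qbar" using subfieldE(3)[OF F] xF by auto
    have K: "subfield K Qbar" unfolding K_def
      by (rule Qbar.generate_field_is_subfield[OF x'])
    interpret K: complex_subfield K by (rule subfield_Qbar_imp_complex_subfield[OF K])
    have KF: "K \<subseteq> F" unfolding K_def
      by (rule Qbar.generate_field_min_subfield1[OF x' F]) (use xF in simp)
    have "subalgebra \<rat> K Qbar"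
      unfolding subalgebra_def subalgebra_axioms_def
      using subring.axioms(1)[OF subfieldE(1)[OF K]] K.Rats_subset by (auto intro: K.mult_mem)
    hence "Qbar.finite_dimension \<rat> K"
      using Qbar.subalbegra_incl_imp_finite_dimension[OF subfield_Rats_Qbar fin _ KF] by simp
    then obtain d where d: "Qbar.dimension d \<rat> K" by (auto simp: Qbar.finite_dimension_def)
    have gd: "global_degree K = d" unfolding global_degree_def
      using Qbar.dimI[OF subfield_Rats_Qbar d] by (simp add: over_def)
    obtain Vs where Vs: "set Vs \<subseteq> carrier Qbar" "Qbar.independent \<rat> Vs" "length Vs = d" "Qbar.Span \<rat> Vs = K"
      using Qbar.exists_base[OF subfield_Rats_Qbar d] by blast
    have "set Vs \<subseteq> K" using Qbar.Span_base_incl[OF subfield_Rats_Qbar Vs(1)] Vs(4) by simp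
    hence "d \<le> n" using Qbar.independent_length_le_dimension[OF subfield_Rats_Qbar n Vs(2)] KF Vs(3) by auto
    moreover have "d \<noteq> 0"
      using Qbar.dimension_zero[OF subfield_Rats_Qbar, of K] d K.one_mem by (cases "d = 0") auto
    ultimately show "0 < global_degree (generate_field Qbar {x}) \<and> global_degree (generate_field Qbar {x}) \<le> n" using gd by (simp add: K_def)
  qed
qed

section \<open>Absolute values on subfields\<close>

text \<open>
  The power trick: a bound up to a constant for a multiplicative function is a bound without it.
\<close>
lemma le_if_powers_le:
  fixes x t C :: real
  assumes "0 \<le> x" "0 \<le> t" "\<And>k. x ^ k \<le> C * t ^ k"
  shows "x \<le> t"
proof (rule ccontr)
  assume "\<not> x \<le> t"
  hence "t < x" by simp
  show False
  proof (cases "t = 0")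
    case True
    then show ?thesis using assms(3)[of 1] \<open>t < x\<close> by simp
  next
    case False
    with assms(2) have "t > 0" by simp
    obtain k where "C < (x / t) ^ k"
      using real_arch_pow[of "x / t" C] \<open>t < x\<close> \<open>t > 0\<close> by auto
    hence "C * t ^ k < x ^ k" using \<open>t > 0\<close> by (simp add: power_divide field_simps)
    with assms(3)[of k] show ?thesis by simp
  qed
qed

locale valued_subfield = complex_subfield +
  fixes v :: "complex \<Rightarrow> real"
  assumes abs_val: "absolute_value_on K v"
begin

lemma v_nonneg: "x \<in> K \<Longrightarrow> 0 \<le> v x"
  and v_eq_0_iff: "x \<in> K \<Longrightarrow> v x = 0 \<longleftrightarrow> x = 0"
  and v_mult: "x \<in> K \<Longrightarrow> y \<in> K \<Longrightarrow> v (x * y) = v x * v y"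
  and v_add: "x \<in> K \<Longrightarrow> y \<in> K \<Longrightarrow> v (x + y) \<le> v x + v y"
  using abs_val by (auto simp: absolute_value_on_def)

lemma v_0: "v 0 = 0"
  using v_eq_0_iff[OF zero_mem] by simp

lemma v_1: "v 1 = 1"
  using v_mult[OF one_mem one_mem] v_eq_0_iff[OF one_mem] by simp

lemma v_power: "x \<in> K \<Longrightarrow> v (x ^ n) = v x ^ n"
  by (induction n) (simp_all add: v_1 v_mult power_mem)

lemma v_sum: "(\<And>i. i \<in> I \<Longrightarrow> f i \<in> K) \<Longrightarrow> v (sum f I) \<le> (\<Sum>i\<in>I. v (f i))"
proof (induction I rule: infinite_finite_induct)
  case (insert i I)
  then show ?case using v_add[of "f i" "sum f I"] sum_mem[of I f] by auto
qed (simp_all add: v_0)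

text \<open>
  All powers of \<open>x\<close> are integral combinations of \<open>1, x, \<dots>, x ^ (m - 1)\<close>, so the powers of \<open>v x\<close>
  are bounded.
\<close>
lemma algebraic_int_v_le_1:
  assumes int: "\<And>k::int. v (of_int k) \<le> 1" and x: "algebraic_int x" "x \<in> K"
  shows "v x \<le> 1"
proof -
  obtain m c where m: "m > 0" and c: "\<And>i. i < m \<Longrightarrow> x * x ^ i = (\<Sum>k<m. of_int (c i k) * x ^ k)"
    using algebraic_int_power_basis[OF x(1)] by metis
  have "\<exists>e :: nat \<Rightarrow> int. x ^ n = (\<Sum>k<m. of_int (e k) * x ^ k)" for n
  proof (induction n)
    case 0
    have "(\<Sum>k<m. of_int (if k = 0 then 1 else 0) * x ^ k) = (\<Sum>k<m. if k = 0 then 1 else 0)"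
      by (intro sum.cong) auto
    thus ?case using m by (intro exI[of _ "\<lambda>k. if k = 0 then 1 else 0"]) simp
  next
    case (Suc n)
    then obtain e :: "nat \<Rightarrow> int" where e: "x ^ n = (\<Sum>k<m. of_int (e k) * x ^ k)" by blast
    have "x ^ Suc n = (\<Sum>k<m. of_int (e k) * (x * x ^ k))"
      by (simp add: e sum_distrib_left mult_ac)
    also have "\<dots> = (\<Sum>k<m. \<Sum>l<m. of_int (e k) * (of_int (c k l) * x ^ l))"
      by (intro sum.cong) (auto simp: c sum_distrib_left)
    also have "\<dots> = (\<Sum>l<m. of_int (\<Sum>k<m. e k * c k l) * x ^ l)"
      by (subst sum.swap) (simp add: sum_distrib_left sum_distrib_right mult_ac)
    finally show ?case by (rule exI[of _ "\<lambda>l. \<Sum>k<m. e k * c k l"])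
  qed
  then obtain e :: "nat \<Rightarrow> nat \<Rightarrow> int" where e: "\<And>n. x ^ n = (\<Sum>k<m. of_int (e n k) * x ^ k)" by metis
  have "v x ^ n \<le> (\<Sum>k<m. v x ^ k) * 1 ^ n" for n
  proof -
    have "v x ^ n = v (\<Sum>k<m. of_int (e n k) * x ^ k)" by (simp add: v_power[OF x(2), symmetric] flip: e)
    also have "\<dots> \<le> (\<Sum>k<m. v (of_int (e n k) * x ^ k))"
      using x(2) by (intro v_sum mult_mem of_int_mem power_mem)
    also have "\<dots> = (\<Sum>k<m. v (of_int (e n k)) * v x ^ k)"
      using x(2) by (simp add: v_mult of_int_mem power_mem v_power)
    also have "\<dots> \<le> (\<Sum>k<m. 1 * v x ^ k)"
      using int x(2) by (intro sum_mono mult_right_mono) (auto simp: v_nonneg)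
    finally show ?thesis by simp
  qed
  thus ?thesis using le_if_powers_le[of "v x" 1] v_nonneg x(2) by auto
qed

end

lemma padic_abs_int_le_1: 
  assumes "Factorial_Ring.prime p"
  shows "padic_abs p (of_int k) \<le> 1"
proof -
  have "real p > 1" using prime_gt_1_nat[OF assms] by simp
  hence "real p powi (- int n) \<le> 1" for n
    by (simp add: power_int_minus power_int_of_nat inverse_le_1_iff)
  thus ?thesis by (simp add: padic_abs_def)
qed

section \<open>Archimedean absolute values come from conjugates\<close>

text \<open>
  The bound that the triangle inequality gives for the absolute value of \<open>P\<close> at a point of
  absolute value \<open>a\<close>.
\<close>
definition weighted_norm :: "real \<Rightarrow> real poly \<Rightarrow> real" where
  "weighted_norm a P = poly (map_poly abs P) a"

lemma weighted_norm_0 [simp]: "weighted_norm a 0 = 0"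
  by (simp add: weighted_norm_def)

lemma weighted_norm_pCons [simp]: "weighted_norm a (pCons c P) = \<bar>c\<bar> + a * weighted_norm a P"
  by (simp add: weighted_norm_def Polynomial.map_poly_pCons)

context
  fixes a :: real assumes a: "a \<ge> 0"
begin

lemma weighted_norm_nonneg: "weighted_norm a P \<ge> 0"
  using a by (induction P) auto

lemma weighted_norm_add: "weighted_norm a (P + Q) \<le> weighted_norm a P + weighted_norm a Q"
proof (induction P Q rule: poly_induct2)
  case (pCons c P d Q)
  have "a * weighted_norm a (P + Q) \<le> a * (weighted_norm a P + weighted_norm a Q)"
    using pCons a by (intro mult_left_mono)
  moreover have "\<bar>c + d\<bar> \<le> \<bar>c\<bar> + \<bar>d\<bar>" by simp
  ultimately show ?case by (simp add: algebra_simps)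
qed simp

lemma weighted_norm_smult: "weighted_norm a (Polynomial.smult c P) = \<bar>c\<bar> * weighted_norm a P"
  by (induction P) (auto simp: abs_mult algebra_simps)

lemma weighted_norm_mult: "weighted_norm a (P * Q) \<le> weighted_norm a P * weighted_norm a Q"
proof (induction P)
  case (pCons c P)
  have "weighted_norm a (pCons c P * Q) \<le> weighted_norm a (Polynomial.smult c Q) + weighted_norm a (pCons 0 (P * Q))"
    unfolding mult_pCons_left by (rule weighted_norm_add)
  also have "\<dots> \<le> \<bar>c\<bar> * weighted_norm a Q + a * (weighted_norm a P * weighted_norm a Q)"
    using pCons a by (auto simp: weighted_norm_smult intro: mult_left_mono)
  finally show ?case by (simp add: algebra_simps)
qed simp

end

definition real_eval :: "real poly \<Rightarrow> complex \<Rightarrow> complex" where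
  "real_eval P z = poly (map_poly of_real P) z"

lemma real_eval_0 [simp]: "real_eval 0 z = 0"
  by (simp add: real_eval_def)

lemma real_eval_pCons [simp]: "real_eval (pCons c P) z = of_real c + z * real_eval P z"
  by (simp add: real_eval_def Polynomial.map_poly_pCons)

lemma real_eval_add [simp]: "real_eval (P + Q) z = real_eval P z + real_eval Q z"
  by (induction P Q rule: poly_induct2) (auto simp: algebra_simps)

lemma real_eval_smult [simp]: "real_eval (Polynomial.smult c P) z = of_real c * real_eval P z"
  by (induction P) (auto simp: algebra_simps)

lemma real_eval_uminus [simp]: "real_eval (- Q) z = - real_eval Q z"
  using real_eval_smult[of "- 1" Q z] by simp

lemma real_eval_diff [simp]: "real_eval (P - Q) z = real_eval P z - real_eval Q z"
  using real_eval_add[of P "- Q" z] by simp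

lemma real_eval_mult [simp]: "real_eval (P * Q) z = real_eval P z * real_eval Q z"
  by (induction P) (auto simp: algebra_simps)

lemma real_eval_power [simp]: "real_eval (P ^ n) z = real_eval P z ^ n"
  by (induction n) (auto simp: one_pCons)

definition rat_poly :: "real poly \<Rightarrow> bool" where
  "rat_poly P \<longleftrightarrow> (\<forall>i. Polynomial.coeff P i \<in> \<rat>)"

lemma rat_poly_0: "rat_poly 0"
  by (simp add: rat_poly_def)

lemma rat_poly_pCons: "c \<in> \<rat> \<Longrightarrow> rat_poly P \<Longrightarrow> rat_poly (pCons c P)"
  by (auto simp: rat_poly_def coeff_pCons split: nat.splits)

lemma rat_poly_add: "rat_poly P \<Longrightarrow> rat_poly Q \<Longrightarrow> rat_poly (P + Q)"
  by (auto simp: rat_poly_def)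

lemma rat_poly_diff: "rat_poly P \<Longrightarrow> rat_poly Q \<Longrightarrow> rat_poly (P - Q)"
  by (auto simp: rat_poly_def)

lemma rat_poly_mult: "rat_poly P \<Longrightarrow> rat_poly Q \<Longrightarrow> rat_poly (P * Q)"
  by (auto simp: rat_poly_def coeff_mult intro!: Rats_sum)

lemma rational_approximation: "\<exists>r :: nat \<Rightarrow> real. range r \<subseteq> \<rat> \<and> r \<longlonglongrightarrow> c"
proof -
  have "\<exists>q\<in>\<rat>. c < q \<and> q < c + inverse (real (Suc n))" for n
    by (rule Rats_dense_in_real) simp
  then obtain r where r: "\<And>n. r n \<in> \<rat> \<and> c < r n \<and> r n < c + inverse (real (Suc n))" by metis
  have "(\<lambda>n. r n - c) \<longlonglongrightarrow> 0"
  proof (rule Lim_null_comparison[OF _ LIMSEQ_inverse_real_of_nat])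
    have "norm (r n - c) \<le> inverse (real (Suc n))" for n using r[of n] by simp
    thus "\<forall>\<^sub>F n in sequentially. norm (r n - c) \<le> inverse (real (Suc n))" by simp
  qed
  hence "r \<longlonglongrightarrow> c" by (simp add: LIM_zero_iff)
  thus ?thesis using r by blast
qed

text \<open>
  Let \<open>v\<close> extend the usual absolute value of the rationals.  The function \<open>P \<mapsto> v (P \<alpha>)\<close> on rational
  polynomials is continuous for the weighted norm with weight \<open>v \<alpha>\<close>, and rational polynomials are
  dense in the real ones, so it extends to a function \<open>V\<close> on real polynomials that is still
  multiplicative and subadditive.  The gain is that real polynomials are products of
  factors of degree at most \<open>2\<close>: one of the factors of the minimal polynomial of \<open>\<alpha>\<close> is annihilated
  by \<open>V\<close>, and its root is the conjugate that gives \<open>v\<close>.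
\<close>
locale archimedean_valuation = valued_subfield +
  fixes \<alpha> :: complex
  assumes \<alpha>_mem: "\<alpha> \<in> K" and v_rat: "\<And>q. v (of_rat q) = \<bar>real_of_rat q\<bar>"
begin

definition approximates :: "(nat \<Rightarrow> real poly) \<Rightarrow> real poly \<Rightarrow> bool" where
  "approximates F P \<longleftrightarrow> (\<forall>n. rat_poly (F n)) \<and> (\<lambda>n. weighted_norm (v \<alpha>) (F n - P)) \<longlonglongrightarrow> 0"

abbreviation W :: "real poly \<Rightarrow> real" where "W P \<equiv> v (real_eval P \<alpha>)"

abbreviation N :: "real poly \<Rightarrow> real" where "N P \<equiv> weighted_norm (v \<alpha>) P"

lemma v\<alpha>_nonneg: "v \<alpha> \<ge> 0" by (rule v_nonneg[OF \<alpha>_mem])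

lemmas N_nonneg = weighted_norm_nonneg[OF v\<alpha>_nonneg]
lemmas N_add = weighted_norm_add[OF v\<alpha>_nonneg]
lemmas N_smult = weighted_norm_smult[OF v\<alpha>_nonneg]
lemmas N_mult = weighted_norm_mult[OF v\<alpha>_nonneg]

lemma N_uminus: "N (- P) = N P"
  using N_smult[of "- 1" P] by simp

lemma N_diff_commute: "N (P - Q) = N (Q - P)"
  using N_uminus[of "P - Q"] by simp

lemma of_real_Rats: "c \<in> \<rat> \<Longrightarrow> complex_of_real c \<in> \<rat>"
  by (auto elim!: Rats_cases)

lemma v_of_real: "c \<in> \<rat> \<Longrightarrow> v (of_real c) = \<bar>c\<bar>"
proof -
  assume "c \<in> \<rat>"
  then obtain q where "c = of_rat q" by (auto elim: Rats_cases)
  moreover have "complex_of_real (of_rat q) = of_rat q"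
    by (cases q) (simp add: of_rat_rat)
  ultimately show ?thesis using v_rat[of q] by simp
qed

lemma real_eval_mem: "rat_poly P \<Longrightarrow> real_eval P \<alpha> \<in> K"
  unfolding real_eval_def
  by (intro poly_mem poly_over_rat \<alpha>_mem) (auto simp: coeff_map_poly rat_poly_def intro: of_real_Rats)

lemma W_le_N: "rat_poly P \<Longrightarrow> W P \<le> N P"
proof (induction P)
  case (pCons c P)
  have c: "c \<in> \<rat>" and P: "rat_poly P" using pCons.prems
    by (auto simp: rat_poly_def coeff_pCons split: nat.splits)
  have cK: "complex_of_real c \<in> K" using Rats_subset of_real_Rats[OF c] by blast
  have "W (pCons c P) \<le> v (of_real c) + v (\<alpha> * real_eval P \<alpha>)"
    using v_add[OF cK mult_mem[OF \<alpha>_mem real_eval_mem[OF P]]] by simp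
  also have "\<dots> = \<bar>c\<bar> + v \<alpha> * W P"
    using v_of_real[OF c] v_mult[OF \<alpha>_mem real_eval_mem[OF P]] by simp
  also have "\<dots> \<le> \<bar>c\<bar> + v \<alpha> * N P"
    using pCons.IH[OF P] v\<alpha>_nonneg by (intro add_left_mono mult_left_mono)
  finally show ?case by simp
qed (simp add: v_0)

lemma W_diff_le: 
  assumes "rat_poly P" "rat_poly Q" 
  shows "\<bar>W P - W Q\<bar> \<le> N (P - Q)"
proof -
  note m = real_eval_mem[OF assms(1)] real_eval_mem[OF assms(2)]
  have "W P \<le> W (P - Q) + W Q" using v_add[OF diff_mem[OF m] m(2)] by simp
  moreover have "W Q \<le> W (Q - P) + W P" using v_add[OF diff_mem[OF m(2,1)] m(1)] by simp
  ultimately show ?thesis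
    using W_le_N[OF rat_poly_diff[OF assms]] W_le_N[OF rat_poly_diff[OF assms(2,1)]] N_diff_commute[of P Q]
    by linarith
qed

lemma exists_approximation: "\<exists>F. approximates F P"
proof (induction P)
  case 0
  show ?case by (intro exI[of _ "\<lambda>_. 0"]) (simp add: approximates_def rat_poly_0)
next
  case (pCons c P)
  then obtain F where F: "approximates F P" by blast
  obtain r :: "nat \<Rightarrow> real" where r: "range r \<subseteq> \<rat>" "r \<longlonglongrightarrow> c" using rational_approximation by blast
  have "(\<lambda>n. \<bar>r n - c\<bar> + v \<alpha> * N (F n - P)) \<longlonglongrightarrow> \<bar>c - c\<bar> + v \<alpha> * 0"
    using F r(2) unfolding approximates_def by (intro tendsto_intros) auto
  hence "approximates (\<lambda>n. pCons (r n) (F n)) (pCons c P)"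
    using F r(1) by (auto simp: approximates_def intro: rat_poly_pCons)
  thus ?case by blast
qed

text \<open>
  The limit exists and does not depend on the approximating sequence, by
  \<open>approximates_imp_tendsto\<close> below.
\<close>
definition V :: "real poly \<Rightarrow> real" where
  "V P = lim (\<lambda>n. W ((SOME F. approximates F P) n))"

text \<open>
  By \<open>W_diff_le\<close>, sequences of rational polynomials that approximate the same real polynomial have
  values under \<open>W\<close> that approach each other.
\<close>
lemma approximates_imp_tendsto:
  assumes F: "approximates F P"
  shows "(\<lambda>n. W (F n)) \<longlonglongrightarrow> V P"
proof -
  define G where "G = (SOME F. approximates F P)"
  have G: "approximates G P" unfolding G_def by (rule someI_ex[OF exists_approximation])
  have tri: "\<bar>W (A m) - W (B n)\<bar> \<le> N (A m - P) + N (B n - P)"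
    if "approximates A P" "approximates B P" for A B m n
  proof -
    have "\<bar>W (A m) - W (B n)\<bar> \<le> N (A m - B n)"
      using that by (intro W_diff_le) (auto simp: approximates_def)
    also have "N (A m - B n) \<le> N (A m - P) + N (P - B n)"
      using N_add[of "A m - P" "P - B n"] by simp
    finally show ?thesis by (simp add: N_diff_commute)
  qed
  have "Cauchy (\<lambda>n. W (G n))"
  proof (rule CauchyI)
    fix e :: real assume "e > 0"
    hence "\<forall>\<^sub>F n in sequentially. N (G n - P) < e / 2"
      using G unfolding approximates_def by (intro order_tendstoD(2)) auto
    then obtain M where M: "\<And>n. n \<ge> M \<Longrightarrow> N (G n - P) < e / 2"
      by (auto simp: eventually_sequentially)
    show "\<exists>M. \<forall>m\<ge>M. \<forall>n\<ge>M. norm (W (G m) - W (G n)) < e"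
    proof (intro exI allI impI)
      fix m n assume "m \<ge> M" "n \<ge> M"
      thus "norm (W (G m) - W (G n)) < e" using tri[OF G G, of m n] M[of m] M[of n] by simp
    qed
  qed
  hence lim: "(\<lambda>n. W (G n)) \<longlonglongrightarrow> V P"
    unfolding V_def G_def[symmetric] by (simp add: Cauchy_convergent_iff convergent_LIMSEQ_iff)
  have "(\<lambda>n. W (F n) - W (G n)) \<longlonglongrightarrow> 0"
  proof (rule Lim_null_comparison)
    show "(\<lambda>n. N (F n - P) + N (G n - P)) \<longlonglongrightarrow> 0"
      using F G tendsto_add[of "\<lambda>n. N (F n - P)" 0 _ "\<lambda>n. N (G n - P)" 0] by (auto simp: approximates_def)
    show "\<forall>\<^sub>F n in sequentially. norm (W (F n) - W (G n)) \<le> N (F n - P) + N (G n - P)"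
      using tri[OF F G] by simp
  qed
  from tendsto_add[OF this lim] show ?thesis by simp
qed

lemma approximates_const: "rat_poly P \<Longrightarrow> approximates (\<lambda>_. P) P"
  by (simp add: approximates_def)

lemma approximates_N: 
  assumes "approximates F P" shows "(\<lambda>n. N (F n)) \<longlonglongrightarrow> N P"
proof (rule Lim_transform2[OF tendsto_const])
  show "(\<lambda>n. N P - N (F n)) \<longlonglongrightarrow> 0"
  proof (rule Lim_null_comparison)
    have "\<bar>N P - N (F n)\<bar> \<le> N (F n - P)" for n
      using N_add[of "F n - P" P] N_add[of "P - F n" "F n"] N_diff_commute[of P "F n"] by simp
    thus "\<forall>\<^sub>F n in sequentially. norm (N P - N (F n)) \<le> N (F n - P)" by simp
  qed (use assms in \<open>auto simp: approximates_def\<close>)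
qed

lemma approximates_add:
  assumes "approximates F P" "approximates G Q"
  shows "approximates (\<lambda>n. F n + G n) (P + Q)"
proof -
  have "(\<lambda>n. N (F n + G n - (P + Q))) \<longlonglongrightarrow> 0"
  proof (rule Lim_null_comparison)
    have "N (F n + G n - (P + Q)) \<le> N (F n - P) + N (G n - Q)" for n
      using N_add[of "F n - P" "G n - Q"] by (simp add: algebra_simps)
    thus "\<forall>\<^sub>F n in sequentially. norm (N (F n + G n - (P + Q))) \<le> N (F n - P) + N (G n - Q)" by (simp add: N_nonneg)
    show "(\<lambda>n. N (F n - P) + N (G n - Q)) \<longlonglongrightarrow> 0"
      using assms tendsto_add[of "\<lambda>n. N (F n - P)" 0 _ "\<lambda>n. N (G n - Q)" 0] by (auto simp: approximates_def)
  qed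
  thus ?thesis using assms by (auto simp: approximates_def intro: rat_poly_add)
qed

lemma approximates_mult:
  assumes "approximates F P" "approximates G Q"
  shows "approximates (\<lambda>n. F n * G n) (P * Q)"
proof -
  have "(\<lambda>n. N (F n * G n - P * Q)) \<longlonglongrightarrow> 0"
  proof (rule Lim_null_comparison)
    have "N (F n * G n - P * Q) \<le> N (F n) * N (G n - Q) + N (F n - P) * N Q" for n
      using N_add[of "F n * (G n - Q)" "(F n - P) * Q"] N_mult[of "F n" "G n - Q"] N_mult[of "F n - P" Q]
      by (simp add: algebra_simps)
    thus "\<forall>\<^sub>F n in sequentially. norm (N (F n * G n - P * Q)) \<le> N (F n) * N (G n - Q) + N (F n - P) * N Q" by (simp add: N_nonneg)
    have "(\<lambda>n. N (F n) * N (G n - Q) + N (F n - P) * N Q) \<longlonglongrightarrow> N P * 0 + 0 * N Q"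
      using assms approximates_N[OF assms(1)] by (intro tendsto_intros) (auto simp: approximates_def)
    thus "(\<lambda>n. N (F n) * N (G n - Q) + N (F n - P) * N Q) \<longlonglongrightarrow> 0" by simp
  qed
  thus ?thesis using assms by (auto simp: approximates_def intro: rat_poly_mult)
qed

lemma V_rat: "rat_poly P \<Longrightarrow> V P = W P"
  using approximates_imp_tendsto[OF approximates_const] LIMSEQ_unique[OF tendsto_const] by metis

lemma V_add: "V (P + Q) \<le> V P + V Q"
proof -
  obtain F G where F: "approximates F P" and G: "approximates G Q" using exists_approximation by metis
  have "W (F n + G n) \<le> W (F n) + W (G n)" for n
    using F G v_add[OF real_eval_mem real_eval_mem, of "F n" "G n"] by (auto simp: approximates_def)
  thus ?thesis
    using LIMSEQ_le[OF approximates_imp_tendsto[OF approximates_add[OF F G]]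
      tendsto_add[OF approximates_imp_tendsto[OF F] approximates_imp_tendsto[OF G]]] by blast
qed

lemma V_mult: "V (P * Q) = V P * V Q"
proof -
  obtain F G where F: "approximates F P" and G: "approximates G Q" using exists_approximation by metis
  have "W (F n * G n) = W (F n) * W (G n)" for n
    using F G v_mult[OF real_eval_mem real_eval_mem, of "F n" "G n"] by (auto simp: approximates_def)
  thus ?thesis
    using LIMSEQ_unique[OF approximates_imp_tendsto[OF approximates_mult[OF F G]]]
      tendsto_mult[OF approximates_imp_tendsto[OF F] approximates_imp_tendsto[OF G]] by simp
qed

lemma V_le_N: "V P \<le> N P"
proof -
  obtain F where F: "approximates F P" using exists_approximation by metis
  have "W (F n) \<le> N (F n)" for n using F by (intro W_le_N) (auto simp: approximates_def)
  thus ?thesis using LIMSEQ_le[OF approximates_imp_tendsto[OF F] approximates_N[OF F]] by blast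
qed

lemma V_nonneg: "V P \<ge> 0"
proof -
  obtain F where F: "approximates F P" using exists_approximation by metis
  have "W (F n) \<ge> 0" for n using F by (intro v_nonneg real_eval_mem) (auto simp: approximates_def)
  thus ?thesis using LIMSEQ_le_const[OF approximates_imp_tendsto[OF F]] by blast
qed

lemma V_1: "V 1 = 1"
  by (simp add: V_rat rat_poly_def one_pCons coeff_pCons v_1 split: nat.splits)

lemma V_power: "V (P ^ n) = V P ^ n"
  by (induction n) (simp_all add: V_1 V_mult)

lemma V_const_nonzero: "c \<noteq> 0 \<Longrightarrow> V [:c:] \<noteq> 0"
  using V_mult[of "[:c:]" "[:inverse c:]"] V_1 by (auto simp: one_pCons)

end

text \<open>The monic irreducible real polynomial with root \<open>\<zeta>\<close>.\<close>
definition real_factor :: "complex \<Rightarrow> real poly" where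
  "real_factor \<zeta> = (if Im \<zeta> = 0 then [:- Re \<zeta>, 1:] else [:(norm \<zeta>)\<^sup>2, - 2 * Re \<zeta>, 1:])"

lemma real_factor_root: "real_eval (real_factor \<zeta>) \<zeta> = 0"
  using cmod_power2[of \<zeta>]
  by (auto simp: real_factor_def complex_eq_iff power2_eq_square algebra_simps)

lemma real_factor_nonzero: "real_factor \<zeta> \<noteq> 0"
  by (auto simp: real_factor_def)

lemma real_factor_degree: "Polynomial.degree (real_factor \<zeta>) = (if Im \<zeta> = 0 then 1 else 2)"
  by (auto simp: real_factor_def)

lemma mod_real_factor_root: "real_eval (P mod real_factor \<zeta>) \<zeta> = real_eval P \<zeta>"
proof -
  have "real_eval P \<zeta> = real_eval (P div real_factor \<zeta> * real_factor \<zeta> + P mod real_factor \<zeta>) \<zeta>" by simp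
  also have "\<dots> = real_eval (P mod real_factor \<zeta>) \<zeta>"
    unfolding real_eval_add real_eval_mult real_factor_root by simp
  finally show ?thesis by simp
qed

text \<open>For nonreal \<open>\<zeta>\<close> the numbers \<open>1\<close> and \<open>\<zeta>\<close> are a basis of the complex numbers over the reals.\<close>
lemma linear_coeff_bound:
  assumes "Im \<zeta> \<noteq> 0"
  shows "\<bar>r1\<bar> \<le> norm (of_real r0 + \<zeta> * of_real r1) / \<bar>Im \<zeta>\<bar>"
    and "\<bar>r0\<bar> \<le> (1 + norm \<zeta> / \<bar>Im \<zeta>\<bar>) * norm (of_real r0 + \<zeta> * of_real r1)"
proof -
  let ?z = "of_real r0 + \<zeta> * of_real r1"
  have "\<bar>Im ?z\<bar> \<le> norm ?z" by (rule abs_Im_le_cmod)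
  thus r1: "\<bar>r1\<bar> \<le> norm ?z / \<bar>Im \<zeta>\<bar>" using assms by (simp add: abs_mult field_simps)
  have "\<bar>r0\<bar> = norm (?z - \<zeta> * of_real r1)" by simp
  also have "\<dots> \<le> norm ?z + norm \<zeta> * \<bar>r1\<bar>" by (rule order_trans[OF norm_triangle_ineq4]) (simp add: norm_mult)
  also have "\<dots> \<le> norm ?z + norm \<zeta> * (norm ?z / \<bar>Im \<zeta>\<bar>)"
    by (intro add_left_mono mult_left_mono r1) simp
  finally show "\<bar>r0\<bar> \<le> (1 + norm \<zeta> / \<bar>Im \<zeta>\<bar>) * norm ?z" by (simp add: algebra_simps)
qed

text \<open>
  The remainder of \<open>P\<close> modulo \<open>real_factor \<zeta>\<close> is the unique polynomial of degree less than that of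
  \<open>real_factor \<zeta>\<close> with the same value at \<open>\<zeta>\<close>, and it depends linearly on this value.
\<close>
lemma mod_real_factor_bound:
  assumes "a \<ge> 0"
  obtains C where "\<And>P. weighted_norm a (P mod real_factor \<zeta>) \<le> C * norm (real_eval P \<zeta>)"
    and "\<And>P. real_eval P \<zeta> = 0 \<Longrightarrow> real_factor \<zeta> dvd P"
proof (cases "Im \<zeta> = 0")
  case True
  have R: "\<exists>c. P mod real_factor \<zeta> = [:c:] \<and> norm (real_eval P \<zeta>) = \<bar>c\<bar>" for P
  proof -
    have "Polynomial.degree (P mod real_factor \<zeta>) = 0"
      using degree_mod_less[OF real_factor_nonzero, of P \<zeta>] real_factor_degree[of \<zeta>] True by auto
    then obtain c where c: "P mod real_factor \<zeta> = [:c:]" by (rule degree_eq_zeroE)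
    hence "real_eval P \<zeta> = of_real c" using mod_real_factor_root[of P \<zeta>] by simp
    thus ?thesis using c by simp
  qed
  show ?thesis
  proof (rule that[of 1])
    show "weighted_norm a (P mod real_factor \<zeta>) \<le> 1 * norm (real_eval P \<zeta>)" for P
      using R[of P] by auto
    show "real_factor \<zeta> dvd P" if "real_eval P \<zeta> = 0" for P
      using R[of P] that by (auto simp: dvd_eq_mod_eq_0)
  qed
next
  case False
  have R: "\<exists>r0 r1. P mod real_factor \<zeta> = [:r0, r1:] \<and> real_eval P \<zeta> = of_real r0 + \<zeta> * of_real r1" for P
  proof -
    have "Polynomial.degree (P mod real_factor \<zeta>) < 2"
      using degree_mod_less[OF real_factor_nonzero, of P \<zeta>] real_factor_degree[of \<zeta>] False by auto
    moreover obtain r0 S where S: "P mod real_factor \<zeta> = pCons r0 S" by (rule pCons_cases)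
    ultimately have "Polynomial.degree S = 0" by (auto split: if_splits)
    then obtain r1 where "S = [:r1:]" by (rule degree_eq_zeroE)
    hence c: "P mod real_factor \<zeta> = [:r0, r1:]" using S by simp
    thus ?thesis using mod_real_factor_root[of P \<zeta>] by (intro exI[of _ r0] exI[of _ r1]) simp
  qed
  define C where "C = (1 + norm \<zeta> / \<bar>Im \<zeta>\<bar>) + a / \<bar>Im \<zeta>\<bar>"
  show ?thesis
  proof (rule that[of C])
    fix P
    obtain r0 r1 where r: "P mod real_factor \<zeta> = [:r0, r1:]" "real_eval P \<zeta> = of_real r0 + \<zeta> * of_real r1"
      using R by blast
    have "\<bar>r0\<bar> + a * \<bar>r1\<bar> \<le> (1 + norm \<zeta> / \<bar>Im \<zeta>\<bar>) * norm (real_eval P \<zeta>) + a * (norm (real_eval P \<zeta>) / \<bar>Im \<zeta>\<bar>)"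
      unfolding r(2) using linear_coeff_bound[OF False] assms by (intro add_mono mult_left_mono) auto
    also have "\<dots> = C * norm (real_eval P \<zeta>)" by (simp add: C_def algebra_simps)
    finally show "weighted_norm a (P mod real_factor \<zeta>) \<le> C * norm (real_eval P \<zeta>)" by (simp add: r(1))
    assume "real_eval P \<zeta> = 0"
    hence z: "of_real r0 + \<zeta> * of_real r1 = 0" using r(2) by simp
    have "r0 = 0" "r1 = 0" using linear_coeff_bound[OF False, where ?r0.0 = r0 and ?r1.0 = r1] unfolding z by auto
    thus "real_factor \<zeta> dvd P" using r(1) by (auto simp: dvd_eq_mod_eq_0)
  qed
qed

lemma real_poly_of_rational:
  assumes "poly_over \<rat> p"
  obtains P where "rat_poly P" "\<And>z. real_eval P z = poly p z" "p = map_poly of_real P"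
proof -
  define P where "P = map_poly Re p"
  have rat: "complex_of_rat q = complex_of_real (of_rat q)" for q
    by (cases q) (simp add: of_rat_rat)
  have re: "complex_of_real (Re x) = x" and Re: "Re x \<in> \<rat>" if "x \<in> \<rat>" for x
    using that by (auto elim!: Rats_cases simp: rat)
  have p: "p = map_poly of_real P"
    using assms by (intro poly_eqI) (auto simp: P_def coeff_map_poly poly_over_def re)
  moreover have "rat_poly P" using assms by (auto simp: rat_poly_def P_def coeff_map_poly poly_over_def Re)
  ultimately show ?thesis using that[of P] by (simp add: real_eval_def)
qed

context archimedean_valuation
begin

text \<open>
  Since \<open>V\<close> is multiplicative and nonzero on nonzero constants, it vanishes on an irreducible
  factor of \<open>P\<close>.
\<close>
lemma null_real_factor:
  assumes "V P = 0" "P \<noteq> 0"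
  obtains \<zeta> where "real_eval P \<zeta> = 0" "V (real_factor \<zeta>) = 0"
proof -
  have "\<exists>\<zeta>. real_eval P \<zeta> = 0 \<and> V (real_factor \<zeta>) = 0"
    using assms
  proof (induction "Polynomial.degree P" arbitrary: P rule: less_induct)
    case less
    have "Polynomial.degree P \<noteq> 0"
    proof
      assume "Polynomial.degree P = 0"
      then obtain c where "P = [:c:]" by (rule degree_eq_zeroE)
      thus False using less.prems V_const_nonzero by auto
    qed
    hence "\<not> constant (poly (map_poly complex_of_real P))" by (simp add: constant_degree)
    then obtain \<zeta> where \<zeta>: "real_eval P \<zeta> = 0"
      unfolding real_eval_def using fundamental_theorem_of_algebra by blast
    then obtain Q where Q: "P = real_factor \<zeta> * Q"
      using mod_real_factor_bound[OF v\<alpha>_nonneg, of \<zeta>] by (metis dvdE)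
    have "Q \<noteq> 0" using less.prems(2) Q by auto
    show ?case
    proof (cases "V (real_factor \<zeta>) = 0")
      case False
      hence "V Q = 0" using less.prems(1) by (simp add: Q V_mult)
      moreover have "Polynomial.degree Q < Polynomial.degree P"
        using \<open>Q \<noteq> 0\<close> real_factor_nonzero[of \<zeta>] real_factor_degree[of \<zeta>] by (simp add: Q degree_mult_eq)
      ultimately obtain \<xi> where "real_eval Q \<xi> = 0" "V (real_factor \<xi>) = 0"
        using less.hyps \<open>Q \<noteq> 0\<close> by blast
      thus ?thesis by (auto simp: Q)
    qed (use \<zeta> in blast)
  qed
  thus ?thesis using that by blast
qed

text \<open>
  Modulo a factor on which \<open>V\<close> vanishes, \<open>P ^ k\<close> reduces to a polynomial whose size is at most a
  constant times \<open>norm (P \<zeta>) ^ k\<close>; the power trick removes the constant.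
\<close>
lemma V_le_eval:
  assumes "V (real_factor \<zeta>) = 0"
  shows "V P \<le> norm (real_eval P \<zeta>)"
proof -
  obtain C where C: "\<And>P. N (P mod real_factor \<zeta>) \<le> C * norm (real_eval P \<zeta>)"
    using mod_real_factor_bound[OF v\<alpha>_nonneg, of \<zeta>] by metis
  show ?thesis
  proof (rule le_if_powers_le)
    fix k
    have "V P ^ k = V (P ^ k div real_factor \<zeta> * real_factor \<zeta> + P ^ k mod real_factor \<zeta>)"
      by (simp add: V_power)
    also have "\<dots> \<le> V (P ^ k div real_factor \<zeta>) * V (real_factor \<zeta>) + V (P ^ k mod real_factor \<zeta>)"
      using V_add V_mult by metis
    also have "\<dots> \<le> N (P ^ k mod real_factor \<zeta>)" using V_le_N by (simp add: assms)
    also have "\<dots> \<le> C * norm (real_eval P \<zeta>) ^ k" using C[of "P ^ k"] by (simp add: norm_power)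
    finally show "V P ^ k \<le> C * norm (real_eval P \<zeta>) ^ k" .
  qed (auto simp: V_nonneg)
qed

text \<open>
  The inequality of \<open>V_le_eval\<close> holds for \<open>P \<alpha>\<close> and for its inverse, so it is an equality.
\<close>
theorem archimedean_is_embedding:
  assumes alg: "algebraic \<alpha>" and gen: "\<And>x. x \<in> K \<Longrightarrow> \<exists>p. poly_over \<rat> p \<and> x = poly p \<alpha>"
  obtains \<zeta> where "conjugate_over \<rat> \<alpha> \<zeta>" 
    "\<And>p. poly_over \<rat> p \<Longrightarrow> v (poly p \<alpha>) = norm (poly p \<zeta>)"
proof -
  interpret Rats: complex_subfield \<rat> by (rule complex_subfield_Rats)
  obtain g where g: "poly_over \<rat> g" "Polynomial.lead_coeff g = 1" "poly g \<alpha> = 0"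
    and dvd: "\<And>q. poly_over \<rat> q \<Longrightarrow> poly q \<alpha> = 0 \<Longrightarrow> g dvd q"
    using Rats.minimal_polynomial[OF alg] by metis
  obtain G where G: "rat_poly G" "\<And>z. real_eval G z = poly g z" "g = map_poly of_real G"
    using real_poly_of_rational[OF g(1)] by metis
  have "V G = 0" using G g(3) by (simp add: V_rat v_0)
  moreover have "G \<noteq> 0" using G(3) g(2) by auto
  ultimately obtain \<zeta> where \<zeta>: "real_eval G \<zeta> = 0" "V (real_factor \<zeta>) = 0"
    by (rule null_real_factor)
  have conj: "conjugate_over \<rat> \<alpha> \<zeta>"
    using \<zeta>(1) dvd unfolding conjugate_over_def G(2) by (metis dvdE mult_zero_left poly_mult)
  have le: "v (poly p \<alpha>) \<le> norm (poly p \<zeta>)" if p: "poly_over \<rat> p" for p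
  proof -
    obtain P where "rat_poly P" "\<And>z. real_eval P z = poly p z"
      using real_poly_of_rational[OF p] by metis
    thus ?thesis using V_le_eval[OF \<zeta>(2), of P] by (simp add: V_rat)
  qed
  show ?thesis
  proof (rule that[OF conj])
    fix p assume p: "poly_over \<rat> p"
    have pK: "poly p \<alpha> \<in> K" using p Rats_subset by (intro poly_mem \<alpha>_mem) (auto simp: poly_over_def)
    show "v (poly p \<alpha>) = norm (poly p \<zeta>)"
    proof (cases "poly p \<alpha> = 0")
      case True
      then show ?thesis using conj p by (auto simp: conjugate_over_def v_0)
    next
      case False
      then obtain q where q: "poly_over \<rat> q" "inverse (poly p \<alpha>) = poly q \<alpha>"
        using gen[OF inverse_mem[OF pK]] by blast
      have "poly (p * q - 1) \<alpha> = 0" using False by (simp flip: q(2))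
      moreover have "poly_over \<rat> (p * q - 1)" 
        using p q(1) by (intro Rats.poly_over_diff Rats.poly_over_mult) (auto simp: poly_over_def one_pCons coeff_pCons split: nat.splits)
      ultimately have "poly (p * q - 1) \<zeta> = 0" using conj by (auto simp: conjugate_over_def)
      hence pq: "norm (poly p \<zeta>) * norm (poly q \<zeta>) = 1" by (simp flip: norm_mult)
      have qK: "poly q \<alpha> \<in> K" using inverse_mem[OF pK False] q(2) by simp
      have "v (poly p \<alpha>) * v (poly q \<alpha>) = 1"
        using False by (simp flip: v_mult[OF pK qK]) (simp flip: q(2) add: v_1)
      hence "1 \<le> v (poly p \<alpha>) * norm (poly q \<zeta>)"
        using le[OF q(1)] v_nonneg[OF pK] by (metis mult_left_mono)
      hence "norm (poly p \<zeta>) * 1 \<le> norm (poly p \<zeta>) * (v (poly p \<alpha>) * norm (poly q \<zeta>))"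
        by (intro mult_left_mono) auto
      also have "\<dots> = v (poly p \<alpha>)" using pq by (simp add: mult_ac)
      finally show ?thesis using le[OF p] by simp
    qed
  qed
qed

end

section \<open>The place of a conjugate and its local degree\<close>

abbreviation CC :: "complex ring" where "CC \<equiv> ring_of_type_algebra"

lemma CC_simps [simp]:
  "carrier CC = UNIV" "monoid.mult CC = (*)" "monoid.one CC = 1"
  "ring.zero CC = 0" "ring.add CC = (+)"
  by (simp_all add: ring_of_type_algebra_def)

lemma CC_a_inv [simp]: "a_inv CC x = - x"
proof -
  interpret CC: Ring.field CC by (rule field_from_type_algebra)
  show ?thesis by (rule CC.minus_equality) auto
qed

lemma CC_m_inv: "x \<noteq> 0 \<Longrightarrow> m_inv CC x = inverse x"
proof -
  interpret CC: Ring.field CC by (rule field_from_type_algebra)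
  show "x \<noteq> 0 \<Longrightarrow> m_inv CC x = inverse x" by (rule CC.inv_char) auto
qed

text \<open>
  A subring of the complex numbers that contains the reals and some nonreal \<open>z\<close> contains the span
  of \<open>1\<close> and \<open>z\<close>.  So \<open>E\<close> is the set of the real or of all complex numbers, and the dimension is \<open>1\<close>
  or \<open>2\<close>.
\<close>
lemma real_subring_dimension:
  assumes E: "subring E CC" and "\<real> \<subseteq> E"
  shows "subfield \<real> (CC\<lparr>carrier := E\<rparr>)"
    and "\<exists>n>0. ring.dimension (CC\<lparr>carrier := E\<rparr>) n \<real> E"
proof -
  interpret CC: Ring.field CC by (rule field_from_type_algebra)
  have R: "subfield \<real> CC"
  proof (rule CC.subfieldI')
    show "subring \<real> CC" by (rule CC.subringI) auto
  qed (auto simp: CC_m_inv)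
  have dim1: "CC.dimension 1 \<real> \<real>" by (rule CC.dimension_one[OF R])
  consider "E = \<real>" | "E = UNIV"
  proof (cases "E \<subseteq> \<real>")
    case True
    with assms(2) that(1) show ?thesis by blast
  next
    case False
    hence "\<exists>z\<in>E. Im z \<noteq> 0" unfolding complex_is_Real_iff subset_iff by blast
    then obtain z where z: "z \<in> E" "Im z \<noteq> 0" by blast
    have "w \<in> E" for w
    proof -
      define b where "b = Im w / Im z"
      have "w = of_real (Re w - b * Re z) + of_real b * z"
        using z(2) by (simp add: complex_eq_iff b_def)
      moreover have "of_real (Re w - b * Re z) \<in> E" "of_real b \<in> E" using assms(2) by auto
      ultimately show ?thesis using subringE(6,7)[OF E] z(1) by (metis CC_simps(2,5))
    qed
    with that(2) show ?thesis by blast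
  qed
  hence "subfield \<real> (CC\<lparr>carrier := E\<rparr>) \<and> (\<exists>n>0. ring.dimension (CC\<lparr>carrier := E\<rparr>) n \<real> E)"
  proof cases
    case 1
    have "Ring.field (CC\<lparr>carrier := \<real>\<rparr>)" by (rule CC.subfield_iff(2)[OF R])
    then interpret S: Ring.field "CC\<lparr>carrier := \<real>\<rparr>" .
    have "subfield \<real> (CC\<lparr>carrier := \<real>\<rparr>)" using S.carrier_is_subfield by simp
    thus ?thesis using S.dimension_one unfolding 1 by (intro conjI exI[of _ 1]) auto
  next
    case 2
    have eq: "CC\<lparr>carrier := E\<rparr> = CC" by (simp add: ring_of_type_algebra_def 2)
    have "CC.line_extension \<real> \<i> \<real> = UNIV"
    proof -
      have "w \<in> CC.line_extension \<real> \<i> \<real>" for w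
        unfolding CC.line_extension_mem_iff
        by (intro bexI[of _ "of_real (Im w)"] bexI[of _ "of_real (Re w)"]) (auto simp: complex_eq_iff)
      thus ?thesis by blast
    qed
    hence "CC.dimension (Suc 1) \<real> E"
      using CC.Suc_dim[OF _ _ dim1, of \<i>] by (simp add: complex_is_Real_iff 2)
    thus ?thesis using R unfolding eq by blast
  qed
  thus "subfield \<real> (CC\<lparr>carrier := E\<rparr>)" "\<exists>n>0. ring.dimension (CC\<lparr>carrier := E\<rparr>) n \<real> E"
    by blast+
qed

text \<open>
  A conjugate \<open>\<zeta>\<close> of \<open>\<alpha>\<close> gives an embedding \<open>\<sigma>\<close> of the field \<open>K\<close> generated by \<open>\<alpha>\<close> with
  \<open>\<sigma> \<alpha> = \<zeta>\<close>, and the absolute value of \<open>\<sigma> x\<close> is a place of \<open>K\<close>.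
\<close>
locale conjugate_embedding =
  fixes \<alpha> \<zeta> :: complex
  assumes alg: "algebraic \<alpha>" and conj: "conjugate_over \<rat> \<alpha> \<zeta>"
begin

definition K :: "complex set" where "K = generate_field Qbar {\<alpha>}"

definition \<sigma> :: "complex \<Rightarrow> complex" where
  "\<sigma> x = poly (SOME p. poly_over \<rat> p \<and> x = poly p \<alpha>) \<zeta>"

definition place :: "complex \<Rightarrow> real" where
  "place x = (if x \<in> K then norm (\<sigma> x) else 0)"

sublocale complex_subfield K
proof -
  interpret Qbar: Ring.field Qbar by (rule field_Qbar)
  show "complex_subfield K" unfolding K_def
    by (intro subfield_Qbar_imp_complex_subfield Qbar.generate_field_is_subfield) (use alg in simp)
qed

sublocale Rats: complex_subfield \<rat> by (rule complex_subfield_Rats)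

lemma \<alpha>_mem: "\<alpha> \<in> K" by (simp add: K_def generate_field.incl)

lemma mem_poly: "x \<in> K \<Longrightarrow> \<exists>p. poly_over \<rat> p \<and> x = poly p \<alpha>"
  using generate_field_singleton_poly[OF alg] unfolding K_def by metis

lemma poly_\<alpha>_mem: "poly_over \<rat> p \<Longrightarrow> poly p \<alpha> \<in> K"
  using Rats_subset by (intro poly_mem \<alpha>_mem) (auto simp: poly_over_def)

lemma \<sigma>_poly: 
  assumes p: "poly_over \<rat> p" shows "\<sigma> (poly p \<alpha>) = poly p \<zeta>"
proof -
  define q where "q = (SOME q. poly_over \<rat> q \<and> poly p \<alpha> = poly q \<alpha>)"
  have "poly_over \<rat> q \<and> poly p \<alpha> = poly q \<alpha>"
    unfolding q_def by (rule someI[of _ p]) (use p in simp)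
  hence "poly_over \<rat> (p - q)" "poly (p - q) \<alpha> = 0" using p by (auto intro: Rats.poly_over_diff)
  hence "poly (p - q) \<zeta> = 0" using conj unfolding conjugate_over_def by blast
  thus ?thesis by (simp add: \<sigma>_def q_def[symmetric])
qed

lemma \<sigma>_add: "x \<in> K \<Longrightarrow> y \<in> K \<Longrightarrow> \<sigma> (x + y) = \<sigma> x + \<sigma> y"
  by (metis mem_poly \<sigma>_poly poly_add Rats.poly_over_add)

lemma \<sigma>_mult: "x \<in> K \<Longrightarrow> y \<in> K \<Longrightarrow> \<sigma> (x * y) = \<sigma> x * \<sigma> y"
  by (metis mem_poly \<sigma>_poly poly_mult Rats.poly_over_mult)

lemma \<sigma>_Rats: "x \<in> \<rat> \<Longrightarrow> \<sigma> x = x"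
  using \<sigma>_poly[of "[:x:]"] Rats.poly_over_pCons[OF _ Rats.poly_over_0, of x] by simp

lemma \<sigma>_uminus: "x \<in> K \<Longrightarrow> \<sigma> (- x) = - \<sigma> x"
  using \<sigma>_mult[of "- 1" x] \<sigma>_Rats[of "- 1"] uminus_mem[OF one_mem] by simp

lemma \<sigma>_diff: "x \<in> K \<Longrightarrow> y \<in> K \<Longrightarrow> \<sigma> (x - y) = \<sigma> x - \<sigma> y"
  using \<sigma>_add[of x "- y"] \<sigma>_uminus[of y] uminus_mem by simp

lemma \<sigma>_eq_0_iff: "x \<in> K \<Longrightarrow> \<sigma> x = 0 \<longleftrightarrow> x = 0"
  using \<sigma>_mult[OF _ inverse_mem, of x x] \<sigma>_Rats[of 1] \<sigma>_Rats[of 0] by (cases "x = 0") auto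

lemma place_poly: "poly_over \<rat> p \<Longrightarrow> place (poly p \<alpha>) = norm (poly p \<zeta>)"
  by (simp add: place_def poly_\<alpha>_mem \<sigma>_poly)

lemma place_\<alpha>: "place \<alpha> = norm \<zeta>"
  using place_poly[of "[:0, 1:]"] by (simp add: Rats.poly_over_pCons Rats.poly_over_0)

lemma place_diff: "x \<in> K \<Longrightarrow> y \<in> K \<Longrightarrow> place (x - y) = norm (\<sigma> x - \<sigma> y)"
  by (simp add: place_def diff_mem \<sigma>_diff)

lemma place_mem_places: "place \<in> places K"
proof -
  have "place (of_rat q) = \<bar>real_of_rat q\<bar>" for q
  proof -
    have "norm (of_rat q :: complex) = \<bar>real_of_rat q\<bar>" by (cases q) (simp add: of_rat_rat norm_divide)
    thus ?thesis by (simp add: place_def of_rat_mem \<sigma>_Rats)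
  qed
  moreover have "absolute_value_on K place"
    by (simp add: absolute_value_on_def place_def \<sigma>_eq_0_iff mult_mem add_mem \<sigma>_mult \<sigma>_add norm_mult norm_triangle_ineq)
  ultimately show ?thesis by (auto simp: places_def place_def)
qed

lemma metric: "Metric_space K (\<lambda>a b. place (a - b))"
proof
  show "place (x - y) = place (y - x)" for x y
    using uminus_mem[of "x - y"] uminus_mem[of "y - x"] \<sigma>_uminus[of "x - y"]
    by (auto simp: place_def)
  show "place (x - y) = 0 \<longleftrightarrow> x = y" if "x \<in> K" "y \<in> K" for x y
    using that \<sigma>_eq_0_iff[of "x - y"] by (simp add: place_def diff_mem)
  show "place (x - z) \<le> place (x - y) + place (y - z)" if "x \<in> K" "y \<in> K" "z \<in> K" for x y z
    using that norm_triangle_ineq[of "\<sigma> x - \<sigma> y" "\<sigma> y - \<sigma> z"] by (simp add: place_diff)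
qed (simp add: place_def)

abbreviation R :: "(nat \<Rightarrow> complex) ring" where "R \<equiv> cauchy_ring K place"

lemma carrier_R: "carrier R = {x. range x \<subseteq> K \<and> convergent (\<lambda>n. \<sigma> (x n))}"
proof -
  have "Metric_space.MCauchy K (\<lambda>a b. place (a - b)) x \<longleftrightarrow> range x \<subseteq> K \<and> Cauchy (\<lambda>n. \<sigma> (x n))" for x
  proof -
    have "place (x m - x n) = norm (\<sigma> (x m) - \<sigma> (x n))" if "range x \<subseteq> K" for m n
      using that by (intro place_diff) auto
    thus ?thesis
      unfolding Metric_space.MCauchy_def[OF metric] Cauchy_def dist_norm by (simp cong: conj_cong)
  qed
  thus ?thesis by (simp add: cauchy_ring_def Cauchy_convergent_iff)
qed

lemma R_simps [simp]:
  "monoid.mult R = (\<lambda>x y n. x n * y n)" "monoid.one R = (\<lambda>n. 1)"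
  "ring.zero R = (\<lambda>n. 0)" "ring.add R = (\<lambda>x y n. x n + y n)"
  by (simp_all add: cauchy_ring_def)

text \<open>
  This map identifies the completion at the place with the closure of \<open>\<sigma> ` K\<close> in the complex
  numbers: it is a ring homomorphism, and its kernel consists of the null sequences.
\<close>
definition \<phi> :: "(nat \<Rightarrow> complex) \<Rightarrow> complex" where
  "\<phi> x = lim (\<lambda>n. \<sigma> (x n))"

lemma carrierD: "x \<in> carrier R \<Longrightarrow> x n \<in> K"
  and \<phi>_tendsto: "x \<in> carrier R \<Longrightarrow> (\<lambda>n. \<sigma> (x n)) \<longlonglongrightarrow> \<phi> x"
  by (auto simp: carrier_R \<phi>_def convergent_LIMSEQ_iff)

lemma carrierI: 
  assumes "\<And>n. x n \<in> K" "(\<lambda>n. \<sigma> (x n)) \<longlonglongrightarrow> l" 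
  shows "x \<in> carrier R" "\<phi> x = l"
  using assms by (auto simp: carrier_R \<phi>_def convergent_def limI)

lemma add_R:
  assumes "x \<in> carrier R" "y \<in> carrier R"
  shows "(\<lambda>n. x n + y n) \<in> carrier R" "\<phi> (\<lambda>n. x n + y n) = \<phi> x + \<phi> y"
proof -
  have *: "(\<lambda>n. \<sigma> (x n + y n)) \<longlonglongrightarrow> \<phi> x + \<phi> y"
    using tendsto_add[OF assms[THEN \<phi>_tendsto]] assms by (simp add: \<sigma>_add carrierD)
  show "(\<lambda>n. x n + y n) \<in> carrier R" "\<phi> (\<lambda>n. x n + y n) = \<phi> x + \<phi> y"
    by (rule carrierI[OF _ *]; use assms in \<open>simp add: add_mem carrierD\<close>)+
qed

lemma mult_R:
  assumes "x \<in> carrier R" "y \<in> carrier R"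
  shows "(\<lambda>n. x n * y n) \<in> carrier R" "\<phi> (\<lambda>n. x n * y n) = \<phi> x * \<phi> y"
proof -
  have *: "(\<lambda>n. \<sigma> (x n * y n)) \<longlonglongrightarrow> \<phi> x * \<phi> y"
    using tendsto_mult[OF assms[THEN \<phi>_tendsto]] assms by (simp add: \<sigma>_mult carrierD)
  show "(\<lambda>n. x n * y n) \<in> carrier R" "\<phi> (\<lambda>n. x n * y n) = \<phi> x * \<phi> y"
    by (rule carrierI[OF _ *]; use assms in \<open>simp add: mult_mem carrierD\<close>)+
qed

lemma const_R:
  assumes "c \<in> K"
  shows "(\<lambda>n. c) \<in> carrier R" "\<phi> (\<lambda>n. c) = \<sigma> c"
  by (rule carrierI[of "\<lambda>n. c", OF assms tendsto_const])+

lemma uminus_R: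
  assumes "x \<in> carrier R"
  shows "(\<lambda>n. - x n) \<in> carrier R"
proof -
  have *: "(\<lambda>n. \<sigma> (- x n)) \<longlonglongrightarrow> - \<phi> x"
    using tendsto_minus[OF assms[THEN \<phi>_tendsto]] assms by (simp add: \<sigma>_uminus carrierD)
  show ?thesis by (rule carrierI[OF _ *]) (use assms in \<open>simp add: uminus_mem carrierD\<close>)
qed

lemma ring_R: "ring R"
proof (rule ringI)
  show "abelian_group R"
  proof (rule abelian_groupI)
    show "\<exists>y\<in>carrier R. y \<oplus>\<^bsub>R\<^esub> x = \<zero>\<^bsub>R\<^esub>" if "x \<in> carrier R" for x
      using uminus_R[OF that] by (intro bexI[of _ "\<lambda>n. - x n"]) auto
  qed (auto simp: add_R const_R zero_mem algebra_simps)
  show "monoid R"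
    by (rule monoidI) (auto simp: mult_R const_R one_mem algebra_simps)
qed (auto simp: algebra_simps)

lemma ring_hom_\<phi>: "ring_hom_ring R CC \<phi>"
  by (rule ring_hom_ringI)
    (auto simp: ring_R ring_from_type_algebra add_R mult_R const_R one_mem \<sigma>_Rats)

lemma kernel_\<phi>: "a_kernel R CC \<phi> = null_sequences K place"
proof -
  have "limitin (Metric_space.mtopology K (\<lambda>a b. place (a - b))) x 0 sequentially \<longleftrightarrow> \<phi> x = 0"
    if x: "x \<in> carrier R" for x
  proof -
    have "place (x n - 0) = norm (\<sigma> (x n))" for n using carrierD[OF x] by (simp add: place_def)
    hence "limitin (Metric_space.mtopology K (\<lambda>a b. place (a - b))) x 0 sequentially 
      \<longleftrightarrow> (\<lambda>n. \<sigma> (x n)) \<longlonglongrightarrow> 0"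
      unfolding Metric_space.limitin_metric[OF metric] tendsto_iff
      using carrierD[OF x] by (auto simp: zero_mem dist_norm)
    also have "\<dots> \<longleftrightarrow> \<phi> x = 0" using \<phi>_tendsto[OF x] LIMSEQ_unique by metis
    finally show ?thesis .
  qed
  thus ?thesis by (auto simp: null_sequences_def a_kernel_def')
qed

text \<open>Every real number is a limit of rationals, and \<open>\<sigma>\<close> fixes the rationals.\<close>
lemma \<phi>_rational: "\<phi> ` {x \<in> carrier R. range x \<subseteq> \<rat>} = \<real>"
proof (intro equalityI subsetI)
  fix z assume "z \<in> \<phi> ` {x \<in> carrier R. range x \<subseteq> \<rat>}"
  then obtain x where x: "x \<in> carrier R" "range x \<subseteq> \<rat>" "z = \<phi> x" by auto
  have "Im (\<sigma> (x n)) = 0" for n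
  proof -
    have "x n \<in> \<rat>" using x(2) by auto
    thus ?thesis by (auto simp: \<sigma>_Rats elim!: Rats_cases')
  qed
  hence "(\<lambda>n. 0) \<longlonglongrightarrow> Im z" using tendsto_Im[OF \<phi>_tendsto[OF x(1)]] x(3) by simp
  from LIMSEQ_unique[OF this tendsto_const] have "Im z = 0" .
  thus "z \<in> \<real>" by (simp add: complex_is_Real_iff)
next
  fix z :: complex assume "z \<in> \<real>"
  then obtain c where c: "z = of_real c" by (auto elim: Reals_cases)
  obtain r :: "nat \<Rightarrow> real" where r: "range r \<subseteq> \<rat>" "r \<longlonglongrightarrow> c" using rational_approximation by blast
  have rat: "complex_of_real (r n) \<in> \<rat>" for n
    using r(1) by (auto simp: image_subset_iff elim!: Rats_cases)
  have "(\<lambda>n. \<sigma> (of_real (r n))) \<longlonglongrightarrow> z"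
    unfolding c \<sigma>_Rats[OF rat] by (intro tendsto_of_real r(2))
  from carrierI[OF _ this] rat Rats_subset show "z \<in> \<phi> ` {x \<in> carrier R. range x \<subseteq> \<rat>}"
    by (intro image_eqI[of _ _ "\<lambda>n. of_real (r n)"]) auto
qed

text \<open>
  The local degree is the dimension singled out by a description, so a dimension has to be
  exhibited.  The map \<open>\<phi>\<close> induces an isomorphism \<open>\<psi>\<close> from the completion to a subring of the
  complex numbers that contains the reals, and \<open>\<psi>\<close> maps the completion of the rationals onto the
  reals.  The dimension is transported back along the inverse of \<open>\<psi>\<close>.
\<close>
lemma local_degree_pos: "local_degree K place > 0"
proof -
  interpret \<phi>: ring_hom_ring R CC \<phi> by (rule ring_hom_\<phi>)
  define E where "E = \<phi> ` carrier R"
  define S where "S = CC\<lparr>carrier := E\<rparr>"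
  define C where "C = completion K place"
  have C: "C = R Quot a_kernel R CC \<phi>" by (simp add: C_def completion_def kernel_\<phi>)
  define \<psi> where "\<psi> = (\<lambda>Y. the_elem (\<phi> ` Y))"
  have iso: "\<psi> \<in> ring_iso C S" unfolding C S_def E_def \<psi>_def by (rule \<phi>.FactRing_iso_set_aux)
  have ringC: "ring C" unfolding C by (rule ideal.quotient_is_ring[OF \<phi>.kernel_is_ideal])
  have ringS: "ring S" unfolding S_def E_def by (rule \<phi>.img_is_ring)
  have E: "subring E CC" unfolding E_def by (rule \<phi>.img_is_subring[OF \<phi>.R.carrier_is_subring])
  have RE: "\<real> \<subseteq> E" using \<phi>_rational unfolding E_def by auto
  define \<theta> where "\<theta> = inv_into (carrier C) \<psi>"
  have iso': "\<theta> \<in> ring_iso S C" unfolding \<theta>_def by (rule ring_iso_set_sym[OF ringC iso])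
  interpret \<theta>: ring_hom_ring S C \<theta>
    by (rule ring_hom_ringI2[OF ringS ringC]) (use iso' in \<open>simp add: ring_iso_def\<close>)
  have bij: "bij_betw \<psi> (carrier C) E" and bij': "bij_betw \<theta> E (carrier C)"
    using iso iso' by (auto simp: ring_iso_def S_def)
  have rat: "rat_completion K place \<subseteq> carrier C"
    by (auto simp: rat_completion_def C_def completion_def FactRing_def A_RCOSETS_def' a_r_coset_def)
  have "\<psi> ` rat_completion K place = \<phi> ` {x \<in> carrier R. range x \<subseteq> \<rat>}"
    unfolding rat_completion_def kernel_\<phi>[symmetric] \<psi>_def
    by (force simp: image_iff)
  hence "\<psi> ` rat_completion K place = \<real>" by (simp add: \<phi>_rational)
  hence \<theta>R: "\<theta> ` \<real> = rat_completion K place"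
    using inv_into_image_cancel[of \<psi> "carrier C"] bij rat unfolding \<theta>_def bij_betw_def by metis
  have \<theta>E: "\<theta> ` E = carrier C" using bij' by (simp add: bij_betw_def)
  have one: "\<one>\<^bsub>C\<^esub> \<noteq> \<zero>\<^bsub>C\<^esub>"
  proof
    assume "\<one>\<^bsub>C\<^esub> = \<zero>\<^bsub>C\<^esub>"
    hence eq: "\<theta> \<one>\<^bsub>S\<^esub> = \<theta> \<zero>\<^bsub>S\<^esub>" by simp
    have inj: "inj_on \<theta> E" and mem: "\<one>\<^bsub>S\<^esub> \<in> E" "\<zero>\<^bsub>S\<^esub> \<in> E"
      using bij' \<theta>.R.one_closed \<theta>.R.zero_closed by (simp_all add: bij_betw_def S_def)
    have "\<one>\<^bsub>S\<^esub> = \<zero>\<^bsub>S\<^esub>" by (rule inj_onD[OF inj eq mem])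
    thus False by (simp add: S_def)
  qed
  have sub: "subfield \<real> S" unfolding S_def by (rule real_subring_dimension(1)[OF E RE])
  obtain n where n: "n > 0" "ring.dimension S n \<real> E"
    using real_subring_dimension(2)[OF E RE] unfolding S_def by blast
  have "ring.dimension C n (rat_completion K place) (carrier C)"
    using \<theta>.inj_hom_dimension[OF sub one _ n(2)] bij' by (simp add: \<theta>R \<theta>E bij_betw_def)
  moreover have "subfield (rat_completion K place) C"
    using \<theta>.img_is_subfield(2)[OF sub one] by (simp add: \<theta>R)
  ultimately have "local_degree K place = n"
    using ring.dimI[OF ringC] unfolding local_degree_def C_def by (simp add: over_def)
  thus ?thesis using n(1) by simp
qed

end

section \<open>Lower bound for the height of an algebraic integer\<close>

lemma finite_conjugates:
  assumes "algebraic x"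
  shows "finite {y. conjugate_over \<rat> x y}"
proof -
  obtain p where "\<And>i. Polynomial.coeff p i \<in> \<rat>" "p \<noteq> 0" "poly p x = 0"
    using assms unfolding algebraic_altdef by blast
  hence "{y. conjugate_over \<rat> x y} \<subseteq> {y. poly p y = 0}" "finite {y. poly p y = 0}"
    by (auto simp: conjugate_over_def poly_over_def poly_roots_finite)
  thus ?thesis by (rule finite_subset)
qed

text \<open>
  A place that extends a \<open>p\<close>-adic absolute value is at most \<open>1\<close> at the algebraic integer \<open>\<alpha>\<close>, and
  any other place belongs to one of the finitely many conjugates of \<open>\<alpha>\<close>.
\<close>
lemma finite_places_above_1:
  assumes "algebraic_int \<alpha>"
  shows "finite {v \<in> places (generate_field Qbar {\<alpha>}). max 1 (v \<alpha>) \<noteq> 1}"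
proof (rule finite_subset)
  have alg: "algebraic \<alpha>" using assms by auto
  define K where "K = generate_field Qbar {\<alpha>}"
  show "finite (conjugate_embedding.place \<alpha> ` {\<zeta>. conjugate_over \<rat> \<alpha> \<zeta>})"
    by (intro finite_imageI finite_conjugates alg)
  have "v \<in> conjugate_embedding.place \<alpha> ` {\<zeta>. conjugate_over \<rat> \<alpha> \<zeta>}"
    if v: "v \<in> places K" "max 1 (v \<alpha>) \<noteq> 1" for v
  proof -
    interpret E: conjugate_embedding \<alpha> \<alpha>
      using alg by unfold_locales (simp_all add: conjugate_over_def)
    have EK: "E.K = K" by (simp add: K_def E.K_def)
    interpret valued_subfield K v
      using E.complex_subfield_axioms v(1) 
      by (auto simp: EK places_def valued_subfield_def valued_subfield_axioms_def)
    have \<alpha>: "\<alpha> \<in> K" using E.\<alpha>_mem EK by simp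
    have big: "v \<alpha> > 1" using v(2) by simp
    have "\<forall>q. v (of_rat q) = \<bar>real_of_rat q\<bar>"
    proof (rule ccontr)
      assume "\<not> ?thesis"
      then obtain p where p: "Factorial_Ring.prime p" "\<And>q. v (of_rat q) = padic_abs p q"
        using v(1) by (auto simp: places_def)
      have "v (of_int k) \<le> 1" for k
        using p(2)[of "of_int k"] padic_abs_int_le_1[OF p(1), of k] by simp
      thus False using algebraic_int_v_le_1[OF _ assms \<alpha>] big by fastforce
    qed
    then interpret archimedean_valuation K v \<alpha>
      using \<alpha> by unfold_locales auto
    obtain \<zeta> where \<zeta>: "conjugate_over \<rat> \<alpha> \<zeta>"
      "\<And>p. poly_over \<rat> p \<Longrightarrow> v (poly p \<alpha>) = norm (poly p \<zeta>)"
      using archimedean_is_embedding[OF alg] E.mem_poly unfolding EK by blast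
    interpret Z: conjugate_embedding \<alpha> \<zeta>
      using alg \<zeta>(1) by unfold_locales
    have ZK: "Z.K = K" by (simp add: K_def Z.K_def)
    have "v x = Z.place x" for x
    proof (cases "x \<in> K")
      case True
      then obtain p where "poly_over \<rat> p" "x = poly p \<alpha>" using Z.mem_poly ZK by blast
      thus ?thesis using \<zeta>(2) Z.place_poly by simp
    next
      case False
      thus ?thesis using v(1) by (simp add: Z.place_def ZK places_def)
    qed
    hence "v = Z.place" by blast
    thus ?thesis using \<zeta>(1) by blast
  qed
  thus "{v \<in> places (generate_field Qbar {\<alpha>}). max 1 (v \<alpha>) \<noteq> 1}
      \<subseteq> conjugate_embedding.place \<alpha> ` {\<zeta>. conjugate_over \<rat> \<alpha> \<zeta>}"
    unfolding K_def by blast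
qed

lemma weil_height_ge_1: "weil_height \<alpha> \<ge> 1"
  unfolding weil_height_def height_over_def
  by (intro prod_ge_1) (auto intro!: ge_one_powr_ge_zero)

text \<open>
  All factors of the height are at least \<open>1\<close>, and the one of the place of \<open>\<zeta>\<close> is at least
  \<open>norm \<zeta> powr (1 / n)\<close> when \<open>norm \<zeta> > 1\<close>, because the local degree is positive and the global degree
  is at most \<open>n\<close>.  That the set of places with a nontrivial factor is finite is essential: the
  product would otherwise be \<open>1\<close>.
\<close>
lemma weil_height_ge_conjugate:
  assumes \<alpha>: "algebraic_int \<alpha>" and \<zeta>: "conjugate_over \<rat> \<alpha> \<zeta>"
    and n: "0 < global_degree (generate_field Qbar {\<alpha>})" "global_degree (generate_field Qbar {\<alpha>}) \<le> n"
  shows "norm \<zeta> \<le> weil_height \<alpha> ^ n"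
proof (cases "norm \<zeta> \<le> 1")
  case True
  thus ?thesis using one_le_power[OF weil_height_ge_1, of \<alpha> n] by linarith
next
  case False
  interpret conjugate_embedding \<alpha> \<zeta>
    using assms by unfold_locales auto
  define d where "d = global_degree K"
  have d: "0 < d" "d \<le> n" using n by (auto simp: d_def K_def)
  define Vs where "Vs = {w \<in> places K. max 1 (w \<alpha>) \<noteq> 1}"
  define f where "f = (\<lambda>w. max 1 (w \<alpha>) powr (real (local_degree K w) / real d))"
  have H: "weil_height \<alpha> = prod f Vs"
    by (simp add: weil_height_def height_over_def Vs_def f_def d_def K_def)
  have fin: "finite Vs" unfolding Vs_def K_def by (rule finite_places_above_1[OF \<alpha>])
  have place_Vs: "place \<in> Vs" using place_mem_places False by (simp add: Vs_def place_\<alpha>)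
  have ge1: "f w \<ge> 1" for w by (auto simp: f_def intro!: ge_one_powr_ge_zero)
  have "prod f Vs = f place * prod f (Vs - {place})" by (rule prod.remove[OF fin place_Vs])
  moreover have "prod f (Vs - {place}) \<ge> 1" using ge1 by (intro prod_ge_1)
  ultimately have "f place \<le> weil_height \<alpha>"
    using mult_left_mono[of 1 "prod f (Vs - {place})" "f place"] ge1[of place] H by simp
  moreover have "norm \<zeta> powr (1 / real n) \<le> f place"
  proof -
    have "1 / real n \<le> real (local_degree K place) / real d"
      using local_degree_pos d by (intro frac_le) auto
    thus ?thesis using False by (simp add: f_def place_\<alpha> powr_mono)
  qed
  ultimately have "norm \<zeta> powr (1 / real n) \<le> weil_height \<alpha>" by simp
  hence "(norm \<zeta> powr (1 / real n)) ^ n \<le> weil_height \<alpha> ^ n" by (intro power_mono) auto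
  moreover have "(norm \<zeta> powr (1 / real n)) ^ n = norm \<zeta>"
    using d False by (subst powr_realpow[symmetric]) (auto simp: powr_powr)
  ultimately show ?thesis by simp
qed

section \<open>The Northcott subring\<close>

lemma northcott_number_field:
  assumes "finite A" "\<And>x. x \<in> A \<Longrightarrow> algebraic x"
  shows "finite {x \<in> generate_field Qbar A. algebraic_int x \<and> log_weil_height x \<le> B}"
proof -
  obtain n where n: "\<And>x. x \<in> generate_field Qbar A \<Longrightarrow> algebraic_degree_le n x"
    "\<And>x. x \<in> generate_field Qbar A \<Longrightarrow>
        0 < global_degree (generate_field Qbar {x}) \<and> global_degree (generate_field Qbar {x}) \<le> n"
    using finitely_generated_field_bounds[OF assms] by blast
  have "norm y \<le> exp B ^ n" 
    if x: "x \<in> generate_field Qbar A" "algebraic_int x" "log_weil_height x \<le> B" 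
      and y: "conjugate_over \<rat> x y" for x y
  proof -
    have "weil_height x \<le> exp B"
    proof -
      have "weil_height x = exp (log_weil_height x)"
        using weil_height_ge_1[of x] by (simp add: log_weil_height_def)
      thus ?thesis using x(3) by simp
    qed
    hence "weil_height x ^ n \<le> exp B ^ n" using weil_height_ge_1[of x] by (intro power_mono) auto
    thus ?thesis using weil_height_ge_conjugate[OF x(2) y] n(2)[OF x(1)] by fastforce
  qed
  thus ?thesis
    using n(1) by (intro finite_subset[OF _ finite_bounded_algebraic_ints[of n "exp B ^ n"]]) auto
qed

theorem proposition1:
  fixes S :: "complex set"
  assumes "subring S Qbar"
  shows "\<exists>T. subring T Qbar \<and> T \<subseteq> S \<and> northcott T \<and> fraction_field S = fraction_field T"
proof -
  interpret Qbar: Ring.field Qbar by (rule field_Qbar)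
  note S = subring_QbarD[OF assms]
  define Z where "Z = {x \<in> S. algebraic_int x}"
  have S_nat: "of_nat k \<in> S" for k using S by (induction k) auto
  have "countable Z"
    by (rule countable_subset[OF _ countable_algebraic]) (use S(1) in \<open>auto simp: Z_def\<close>)
  moreover have "Z \<noteq> {}" using S(2) by (auto simp: Z_def)
  ultimately obtain a :: "nat \<Rightarrow> complex" where a: "range a = Z"
    using range_from_nat_into by metis
  have a_alg: "algebraic (a k)" and a_int: "algebraic_int (a k)" and a_S: "a k \<in> S" for k
    using a S(1) by (auto simp: Z_def)
  define K where "K = (\<lambda>n. generate_field Qbar (a ` {..<n}))"
  have sub: "a ` {..<n} \<subseteq> carrier Qbar" for n using a_alg by auto
  have K: "complex_subfield (K n)" for n unfolding K_def
    by (intro subfield_Qbar_imp_complex_subfield Qbar.generate_field_is_subfield sub)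
  have a_K: "a k \<in> K n" if "k < n" for k n
    using that by (auto simp: K_def intro: generate_field.incl)
  have K_mono: "K m \<subseteq> K n" if "m \<le> n" for m n unfolding K_def
    by (rule Qbar.mono_generate_field) (use that sub in auto)
  have fin: "finite {x \<in> K n. algebraic_int x \<and> log_weil_height x \<le> B}" for n B
    unfolding K_def by (rule northcott_number_field) (use a_alg in auto)
  \<comment> \<open>The elements of bounded height that are new in \<open>K (Suc n)\<close>; \<open>m n\<close> has to keep them out of \<open>T\<close>.\<close>
  define bad where "bad = (\<lambda>n. {x \<in> K (Suc n). algebraic_int x \<and> log_weil_height x \<le> real n} - K n)"
  have fin_bad: "finite (bad n)" for n unfolding bad_def by (rule finite_Diff[OF fin])
  have bad: "\<forall>x\<in>bad n. algebraic_int x \<and> x \<notin> K n" for n by (simp add: bad_def)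
  have "\<forall>n. \<exists>c::nat. c > 0 \<and> (\<forall>x\<in>bad n. \<forall>m t r. c dvd m \<longrightarrow> m > 0 \<longrightarrow> t \<in> K n \<longrightarrow>
      algebraic_int r \<longrightarrow> x \<noteq> t + of_nat m * r)"
    by (intro allI exists_modulus_for_finite_set K fin_bad bad)
  from choice[OF this] obtain c :: "nat \<Rightarrow> nat" where c_all:
    "\<forall>n. c n > 0 \<and> (\<forall>x\<in>bad n. \<forall>m t r. c n dvd m \<longrightarrow> m > 0 \<longrightarrow> t \<in> K n \<longrightarrow>
      algebraic_int r \<longrightarrow> x \<noteq> t + of_nat m * r)" ..
  have c_pos: "c n > 0" for n using c_all by blast
  have c: "x \<noteq> t + of_nat m * r" if "x \<in> bad n" "c n dvd m" "m > 0" "t \<in> K n" "algebraic_int r" for n x m t r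
    using c_all that by blast
  \<comment> \<open>Cumulative products, so that the moduli divide each other: then \<open>of_nat (m k) * a k\<close>
     vanishes modulo \<open>m n\<close> for \<open>n \<le> k\<close>.\<close>
  define m where "m = (\<lambda>n. prod c {..n})"
  have m_pos: "m n > 0" for n using c_pos by (auto simp: m_def intro: prod_pos)
  have c_dvd: "c n dvd m n" for n unfolding m_def by (rule dvd_prodI) auto
  have m_dvd: "m i dvd m j" if "i \<le> j" for i j
    unfolding m_def by (rule prod_dvd_prod_subset) (use that in auto)
  define T where "T = Z \<inter> (\<Inter>n. congruence_ring (K n) (m n))"
  note cong = congruence_ring_closed[OF K]
  have T_S: "T \<subseteq> S" by (auto simp: T_def Z_def)
  have T: "subring T Qbar"
  proof (rule subring_QbarI)
    show "algebraic x" if "x \<in> T" for x using that T_S S(1) by auto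
    show "1 \<in> T" using S(3) cong(1) by (auto simp: T_def Z_def)
    show "- x \<in> T" if "x \<in> T" for x using that S(4) cong(2) by (auto simp: T_def Z_def)
    show "x * y \<in> T" "x + y \<in> T" if "x \<in> T" "y \<in> T" for x y
      using that S(5,6) cong(3,4) algebraic_int_add[of x y] algebraic_int_mult[of x y]
      by (auto simp: T_def Z_def)
  qed
  note T' = subring_QbarD[OF T]
  have ma_T: "of_nat (m k) * a k \<in> T" for k
  proof -
    have int: "algebraic_int (of_nat (m k) * a k)"
      by (rule algebraic_int_mult[OF algebraic_int_of_nat a_int])
    have "of_nat (m k) * a k \<in> congruence_ring (K n) (m n)" for n
    proof (cases "k < n")
      case True
      interpret complex_subfield "K n" by (rule K)
      have "of_nat (m k) * a k \<in> K n" by (rule mult_mem[OF of_nat_mem a_K[OF True]])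
      thus ?thesis unfolding congruence_ring_def using int by (intro CollectI exI[of _ "of_nat (m k) * a k"] exI[of _ 0]) auto
    next
      case False
      interpret complex_subfield "K n" by (rule K)
      obtain j where j: "m k = m n * j" using m_dvd[of n k] False by (auto elim: dvdE)
      have "algebraic_int (of_nat j * a k)"
        by (rule algebraic_int_mult[OF algebraic_int_of_nat a_int])
      thus ?thesis unfolding congruence_ring_def using zero_mem j
        by (intro CollectI exI[of _ 0] exI[of _ "of_nat j * a k"]) auto
    qed
    moreover have "of_nat (m k) * a k \<in> Z" using int S(5)[OF S_nat a_S] by (auto simp: Z_def)
    ultimately show ?thesis by (auto simp: T_def)
  qed
  have T_nat: "of_nat k \<in> T" for k using T' by (induction k) auto
  have "fraction_field S \<subseteq> fraction_field T"
  proof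
    \<comment> \<open>Every element of \<open>S\<close> is a fraction with numerator in \<open>T\<close> and positive integer denominator.\<close>
    have frac: "\<exists>t n. t \<in> T \<and> n > 0 \<and> s = t / of_nat n" if s: "s \<in> S" for s
    proof -
      obtain N where N: "N > 0" "algebraic_int (of_nat N * s)"
        using algebraic_obtain_multiple[OF S(1)[OF s]] .
      hence "of_nat N * s \<in> Z" using S(5)[OF S_nat s] by (auto simp: Z_def)
      hence "of_nat N * s \<in> range a" using a by simp
      then obtain k where k: "of_nat N * s = a k" by auto
      have "s = of_nat (m k) * a k / of_nat (m k * N)" using N(1) m_pos[of k] by (simp flip: k)
      moreover have "0 < m k * N" using N(1) m_pos[of k] by simp
      ultimately show ?thesis using ma_T[of k] by blast
    qed
    fix x assume "x \<in> fraction_field S"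
    then obtain p q where x: "p \<in> S" "q \<in> S" "q \<noteq> 0" "x = p / q" by (auto simp: fraction_field_def)
    obtain t n where t: "t \<in> T" "n > 0" "p = t / of_nat n" using frac[OF x(1)] by blast
    obtain u k where u: "u \<in> T" "k > 0" "q = u / of_nat k" using frac[OF x(2)] by blast
    have "x = (t * of_nat k) / (u * of_nat n)" "u * of_nat n \<noteq> 0" using t u x by auto
    moreover have "t * of_nat k \<in> T" "u * of_nat n \<in> T"
      by (rule T'(5)[OF t(1) T_nat], rule T'(5)[OF u(1) T_nat])
    ultimately show "x \<in> fraction_field T" unfolding fraction_field_def by blast
  qed
  moreover have "fraction_field T \<subseteq> fraction_field S" using T_S by (auto simp: fraction_field_def)
  moreover have "northcott T" unfolding northcott_def
  proof (intro allI impI)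
    fix B :: real assume "B \<ge> 0"
    define N where "N = nat \<lceil>B\<rceil>"
    have "x \<in> K N" if x: "x \<in> T" "log_weil_height x \<le> B" for x
    proof -
      have int: "algebraic_int x" using x(1) by (auto simp: T_def Z_def)
      obtain k where "x = a k" using x(1) a by (auto simp: T_def)
      hence ex: "\<exists>n. x \<in> K n" using a_K[of k "Suc k"] by auto
      define n where "n = (LEAST n. x \<in> K n)"
      have n: "x \<in> K n" unfolding n_def using ex by (rule LeastI_ex)
      \<comment> \<open>Otherwise \<open>x\<close> is new in \<open>K n\<close>, so its membership in \<open>T\<close> contradicts the choice of
         \<open>m (n - 1)\<close>.\<close>
      have "n \<le> N"
      proof (rule ccontr)
        assume "\<not> n \<le> N"
        then obtain j where j: "n = Suc j" "N \<le> j" by (cases n) auto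
        have "x \<notin> K j" using not_less_Least[of j "\<lambda>n. x \<in> K n"] j(1) by (simp add: n_def)
        moreover have "B \<le> real j" using j(2) by (simp add: N_def)
        moreover have "x \<in> congruence_ring (K j) (m j)" using x(1) by (simp add: T_def)
        then obtain t r where "x = t + of_nat (m j) * r" "t \<in> K j" "algebraic_int r"
          by (auto simp: congruence_ring_def)
        ultimately show False using c[of x j "m j" t r] n int x(2) c_dvd m_pos j(1) by (auto simp: bad_def)
      qed
      thus ?thesis using K_mono n by blast
    qed
    hence "{x \<in> T. log_weil_height x \<le> B} \<subseteq> {x \<in> K N. algebraic_int x \<and> log_weil_height x \<le> B}"
      by (auto simp: T_def Z_def)
    thus "finite {x \<in> T. log_weil_height x \<le> B}" using fin finite_subset by blast
  qed
  ultimately show ?thesis using T T_S by blast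
qed

end
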